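(* Let $\mathscr{H}$ be a complex Hilbert space and let $T\in \mathbb{B}(\mathscr{H})$. Then for $1\leq r \leq 2$, $$w^2(T) \leq \left\| \int_{0}^{1}\big( tT^*T+(1-t)TT^*\big)^r dt \right \|^{1/r} \leq \left\|\frac{(T^*T)^r+(TT^* )^r}{2}\right\|^{1/r}.$$
   Context: $\mathbb{B}(\mathscr{H})$ denotes the bounded linear operators on $\mathscr{H}$, $\|\cdot\|$ the operator norm. The numerical radius is $w(T)=\sup\{|\langle Tx,x\rangle| : x\in\mathscr{H},\ \|x\|=1\}$, and $w^2(T)=(w(T))^2$. Powers of positive operators are given by the continuous functional calculus. *)

theory Defs
  imports "HOL-Analysis.Analysis"
begin

text \<open>The inner product is linear in its first argument. Positive definiteness is
  contained in \<open>cinner_self\<close>, which also says that the norm is the one induced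
  by the inner product.\<close>

class complex_inner = real_normed_vector +
  fixes scaleC :: "complex \<Rightarrow> 'a \<Rightarrow> 'a" (infixr "*\<^sub>C" 75)
    and cinner :: "'a \<Rightarrow> 'a \<Rightarrow> complex"
  assumes scaleC_add_right: "c *\<^sub>C (x + y) = c *\<^sub>C x + c *\<^sub>C y"
    and scaleC_add_left: "(c + d) *\<^sub>C x = c *\<^sub>C x + d *\<^sub>C x"
    and scaleC_scaleC: "c *\<^sub>C (d *\<^sub>C x) = (c * d) *\<^sub>C x"
    and scaleR_eq_scaleC: "a *\<^sub>R x = complex_of_real a *\<^sub>C x"
    and cinner_add_left: "cinner (x + y) z = cinner x z + cinner y z"
    and cinner_scaleC_left: "cinner (c *\<^sub>C x) y = c * cinner x y"
    and cinner_commute: "cinner x y = cnj (cinner y x)"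
    and cinner_self: "cinner x x = complex_of_real ((norm x)\<^sup>2)"

class complex_hilbert_space = complex_inner + banach

instantiation complex :: complex_hilbert_space
begin
definition scaleC_complex :: "complex \<Rightarrow> complex \<Rightarrow> complex"
  where "scaleC_complex c z = c * z"
definition cinner_complex :: "complex \<Rightarrow> complex \<Rightarrow> complex"
  where "cinner_complex z w = z * cnj w"
instance
  by standard
    (auto simp: scaleC_complex_def cinner_complex_def algebra_simps scaleR_conv_of_real
      complex_norm_square[symmetric] simp flip: of_real_power)
end

text \<open>The type of \<open>blinfun\<close> consists of the bounded real-linear maps, so
  the algebra of bounded operators on a complex space is the (closed) subset of its
  complex-linear elements; the norm of \<open>blinfun\<close> is the operator norm.\<close>

definition bounded_operators :: "('a::complex_inner \<Rightarrow>\<^sub>L 'a) set"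
  where "bounded_operators = {T. \<forall>c x. blinfun_apply T (c *\<^sub>C x) = c *\<^sub>C blinfun_apply T x}"

definition cadjoint :: "('a::complex_hilbert_space \<Rightarrow>\<^sub>L 'a) \<Rightarrow> ('a \<Rightarrow>\<^sub>L 'a)"
  where "cadjoint T =
    (THE S. \<forall>x y. cinner (blinfun_apply T x) y = cinner x (blinfun_apply S y))"

text \<open>All values are nonnegative, so adding \<open>0\<close> changes the supremum only
  on the zero space, where it makes the supremum over the empty unit sphere equal to \<open>0\<close>.\<close>

definition numerical_radius :: "('a::complex_hilbert_space \<Rightarrow>\<^sub>L 'a) \<Rightarrow> real"
  where "numerical_radius T =
    Sup (insert 0 {cmod (cinner (blinfun_apply T x) x) | x. norm x = 1})"

definition op_spectrum :: "('a::complex_hilbert_space \<Rightarrow>\<^sub>L 'a) \<Rightarrow> complex set"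
  where "op_spectrum A = {z. \<not> (\<exists>S \<in> bounded_operators. \<forall>x.
      blinfun_apply S (blinfun_apply A x - z *\<^sub>C x) = x \<and>
      blinfun_apply A (blinfun_apply S x) - z *\<^sub>C blinfun_apply S x = x)}"

text \<open>A continuous unital *-homomorphism from the continuous complex functions on the
  spectrum of \<open>A\<close> (with the supremum norm) to the bounded operators, sending the
  identity function to \<open>A\<close>. Elements of the domain are represented by functions on
  all of the complex plane; the continuity condition forces the value to depend only on the
  restriction to the spectrum. For normal \<open>A\<close> there is exactly one such map.\<close>

definition is_functional_calculus ::
    "('a::complex_hilbert_space \<Rightarrow>\<^sub>L 'a) \<Rightarrow> ((complex \<Rightarrow> complex) \<Rightarrow> ('a \<Rightarrow>\<^sub>L 'a)) \<Rightarrow> bool"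
  where "is_functional_calculus A \<Phi> \<longleftrightarrow>
    (\<forall>f. continuous_on (op_spectrum A) f \<longrightarrow>
        \<Phi> f \<in> bounded_operators \<and>
        \<Phi> (\<lambda>z. cnj (f z)) = cadjoint (\<Phi> f) \<and>
        (\<forall>c x. blinfun_apply (\<Phi> (\<lambda>z. c * f z)) x = c *\<^sub>C blinfun_apply (\<Phi> f) x)) \<and>
    (\<forall>f g. continuous_on (op_spectrum A) f \<longrightarrow> continuous_on (op_spectrum A) g \<longrightarrow>
        \<Phi> (\<lambda>z. f z + g z) = \<Phi> f + \<Phi> g \<and>
        \<Phi> (\<lambda>z. f z * g z) = \<Phi> f o\<^sub>L \<Phi> g) \<and>
    \<Phi> (\<lambda>z. 1) = id_blinfun \<and>
    \<Phi> (\<lambda>z. z) = A \<and>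
    (\<exists>C. \<forall>f M. continuous_on (op_spectrum A) f \<longrightarrow> 0 \<le> M \<longrightarrow>
        (\<forall>z \<in> op_spectrum A. cmod (f z) \<le> M) \<longrightarrow> norm (\<Phi> f) \<le> C * M)"

definition functional_calculus ::
    "('a::complex_hilbert_space \<Rightarrow>\<^sub>L 'a) \<Rightarrow> (complex \<Rightarrow> complex) \<Rightarrow> ('a \<Rightarrow>\<^sub>L 'a)"
  where "functional_calculus A f = (THE B. \<exists>\<Phi>. is_functional_calculus A \<Phi> \<and> \<Phi> f = B)"

text \<open>Meant for positive \<open>A\<close>, whose spectrum lies in the nonnegative reals, and
  \<open>r > 0\<close>.\<close>

definition op_powr :: "('a::complex_hilbert_space \<Rightarrow>\<^sub>L 'a) \<Rightarrow> real \<Rightarrow> ('a \<Rightarrow>\<^sub>L 'a)"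
  where "op_powr A r = functional_calculus A (\<lambda>z. complex_of_real (Re z powr r))"

end

theory Submission
  imports Defs "HOL-Computational_Algebra.Fundamental_Theorem_Algebra"
begin

text \<open>Let \<open>C\<^sub>t = t T*T + (1 - t) TT*\<close>. For a unit vector \<open>x\<close>, Cauchy--Schwarz bounds
  \<open>\<bar>\<langle>Tx, x\<rangle>\<bar>\<^sup>2\<close> by both \<open>\<parallel>Tx\<parallel>\<^sup>2 = \<langle>T*T x, x\<rangle>\<close> and \<open>\<parallel>T*x\<parallel>\<^sup>2 = \<langle>TT* x, x\<rangle>\<close>, hence by
  \<open>\<langle>C\<^sub>t x, x\<rangle>\<close>; the scalar Jensen inequality then gives \<open>\<bar>\<langle>Tx, x\<rangle>\<bar>\<close> to the power \<open>2r\<close> at most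
  \<open>\<langle>C\<^sub>t\<^sup>r x, x\<rangle>\<close>, and integrating over \<open>t\<close> yields the first inequality. The second one is the
  operator convexity of \<open>x\<^sup>r\<close> for \<open>1 \<le> r \<le> 2\<close>, integrated over \<open>t\<close>. It holds because \<open>x\<^sup>r\<close> is a
  locally uniform limit of nonnegative combinations of \<open>x\<^sup>2 / (x + s) = x - s + s\<^sup>2 / (x + s)\<close>.
  The functional calculus exists because a self-adjoint operator has \<open>\<parallel>A\<parallel>\<close> or \<open>-\<parallel>A\<parallel>\<close> in its
  spectrum, which makes \<open>p \<mapsto> p(A)\<close> a contraction for the supremum norm on the spectrum.\<close>

section \<open>Complex inner product spaces\<close>

text \<open>\<open>op_powr\<close> is a definite description over all functional calculi of an
  operator, so no power can be handled before a calculus is known to exist and to be unique.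
  Equations in the Hilbert space are solved by one device, minimisation of a coercive quadratic
  form: it yields the adjoint, and also the surjectivity of \<open>A - z I\<close> for self-adjoint
  \<open>A\<close> whenever \<open>A - z I\<close> is bounded below, which turns spectral membership
  into norm estimates. The range of \<open>r\<close> enters through
  \<open>x powr r = x * x powr (r - 1)\<close>: for \<open>r\<close> strictly between 1 and 2 the
  second factor is a limit of nonnegative combinations of \<open>x / (x + s)\<close>, and the two
  endpoints are handled on their own. The integrand is operator-valued, so norm continuity of the
  powers in \<open>t\<close> has to be established, although the spectrum moves with
  \<open>t\<close>.\<close>

lemma scaleC_one [simp]: "1 *\<^sub>C x = (x::'a::complex_inner)"
  using scaleR_eq_scaleC[of 1 x] by simp

lemma scaleC_scaleR: "c *\<^sub>C (a *\<^sub>R x) = a *\<^sub>R (c *\<^sub>C (x::'a::complex_inner))"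
  by (simp add: scaleR_eq_scaleC scaleC_scaleC mult.commute)

lemma norm_scaleC [simp]: "norm (c *\<^sub>C x) = cmod c * norm (x::'a::complex_inner)"
proof -
  have "cinner (c *\<^sub>C x) (c *\<^sub>C x) = c * cnj c * cinner x x"
    by (metis cinner_commute cinner_scaleC_left complex_cnj_mult mult.assoc)
  also have "\<dots> = complex_of_real ((cmod c * norm x)\<^sup>2)"
    by (simp add: cinner_self complex_norm_square[symmetric] power_mult_distrib)
  finally have "(norm (c *\<^sub>C x))\<^sup>2 = (cmod c * norm x)\<^sup>2"
    by (simp only: cinner_self of_real_eq_iff)
  then show ?thesis by (simp add: power2_eq_iff_nonneg)
qed

lemma bounded_bilinear_scaleC:
  "bounded_bilinear (scaleC :: complex \<Rightarrow> 'a \<Rightarrow> 'a::complex_inner)"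
proof
  show "\<exists>K. \<forall>c (x::'a). norm (c *\<^sub>C x) \<le> norm c * norm x * K"
    by (rule exI[of _ 1]) simp
qed (simp_all add: scaleC_add_left scaleC_add_right scaleC_scaleR,
     simp add: scaleR_eq_scaleC scaleC_scaleC scaleC_complex_def)

interpretation scaleC: bounded_bilinear "scaleC :: complex \<Rightarrow> 'a \<Rightarrow> 'a::complex_inner"
  by (rule bounded_bilinear_scaleC)

declare scaleC.zero_left [simp] scaleC.zero_right [simp]

lemma cinner_add_right: "cinner x (y + z) = cinner x y + cinner x (z::'a::complex_inner)"
  by (metis cinner_add_left cinner_commute complex_cnj_add)

lemma cinner_scaleC_right: "cinner x (c *\<^sub>C y) = cnj c * cinner x (y::'a::complex_inner)"
  by (metis cinner_scaleC_left cinner_commute complex_cnj_mult)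

lemma Re_cinner_self: "Re (cinner x x) = (norm (x::'a::complex_inner))\<^sup>2"
  by (simp add: cinner_self)

lemma Re_cinner_commute: "Re (cinner x y) = Re (cinner y (x::'a::complex_inner))"
  by (subst cinner_commute) simp

lemma norm_add_sqr: "(norm (x + y))\<^sup>2 = (norm x)\<^sup>2 + 2 * Re (cinner x y) + (norm (y::'a::complex_inner))\<^sup>2"
  using Re_cinner_commute[of x y]
  by (simp add: Re_cinner_self[symmetric] cinner_add_left cinner_add_right)

text \<open>The triangle inequality belongs to the class; squaring it and cancelling the squared
  norms leaves Cauchy-Schwarz for the real part.\<close>

lemma Re_cinner_le: "Re (cinner x y) \<le> norm x * norm (y::'a::complex_inner)"
proof -
  have "(norm (x + y))\<^sup>2 \<le> (norm x + norm y)\<^sup>2"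
    by (simp add: norm_triangle_ineq power_mono)
  then show ?thesis by (simp add: norm_add_sqr power2_sum)
qed

lemma cmod_cinner_le: "cmod (cinner x y) \<le> norm x * norm (y::'a::complex_inner)"
proof (cases "cinner x y = 0")
  case False
  \<comment> \<open>A unimodular factor that rotates the inner product onto the nonnegative real
    axis, where modulus and real part agree.\<close>
  define c where "c = cnj (cinner x y) / cmod (cinner x y)"
  have "c * cinner x y = complex_of_real (cmod (cinner x y))"
    using False by (simp add: c_def mult.commute[of "cnj _"] complex_norm_square[symmetric] power2_eq_square)
  then have "cmod (cinner x y) = Re (cinner (c *\<^sub>C x) y)"
    by (simp add: cinner_scaleC_left)
  also have "\<dots> \<le> cmod c * norm x * norm y"
    using Re_cinner_le[of "c *\<^sub>C x" y] by simp
  also have "cmod c = 1" using False by (simp add: c_def norm_divide)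
  finally show ?thesis by simp
qed simp

interpretation cinner: bounded_bilinear "cinner :: 'a::complex_inner \<Rightarrow> 'a \<Rightarrow> complex"
proof
  show "\<exists>K. \<forall>x y::'a. norm (cinner x y) \<le> norm x * norm y * K"
    by (rule exI[of _ 1]) (simp add: cmod_cinner_le)
qed (simp_all add: cinner_add_left cinner_add_right scaleR_eq_scaleC cinner_scaleC_left
    cinner_scaleC_right scaleC_complex_def)

declare cinner.zero_left [simp] cinner.zero_right [simp]

lemma bounded_bilinear_Re_cinner:
  "bounded_bilinear (\<lambda>x y::'a::complex_inner. Re (cinner x y))"
proof
  show "\<exists>K. \<forall>x y::'a. norm (Re (cinner x y)) \<le> norm x * norm y * K"
    by (rule exI[of _ 1]) (metis abs_Re_le_cmod cmod_cinner_le mult.right_neutral order_trans real_norm_def)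
qed (simp_all add: cinner_add_left cinner_add_right cinner.scaleR_left cinner.scaleR_right)

text \<open>Testing against \<open>y - z\<close> produces the squared norm of \<open>y - z\<close>,
  which is real, so real parts suffice.\<close>

lemma cinner_eqI:
  fixes y z :: "'a::complex_inner"
  assumes "\<And>x. Re (cinner x y) = Re (cinner x z)"
  shows "y = z"
  using assms[of "y - z"] Re_cinner_self[of "y - z"] by (simp add: cinner.diff_right)

text \<open>The solution minimises the energy \<open>a x x - 2 * f x\<close>. Coercivity bounds the
  energy below and, through the parallelogram identity, makes every minimising sequence Cauchy. It
  is applied to the inner product itself (Riesz representation) and to the form
  \<open>Re (cinner (B x) (B y))\<close>.\<close>

theorem symmetric_Lax_Milgram:
  fixes a :: "'a::banach \<Rightarrow> 'a \<Rightarrow> real"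
  assumes a: "bounded_bilinear a" and sym: "\<And>x y. a x y = a y x"
    and c: "0 < c" and coercive: "\<And>x. c * (norm x)\<^sup>2 \<le> a x x"
    and f: "bounded_linear f"
  obtains u where "\<And>x. a x u = f x"
proof -
  interpret a: bounded_bilinear a by (rule a)
  interpret f: bounded_linear f by (rule f)
  define J where "J x = a x x - 2 * f x" for x
  define m where "m = Inf (range J)"
  obtain K where K: "\<And>x. norm (f x) \<le> norm x * K" "0 < K"
    using f.pos_bounded by blast
  have "- (K\<^sup>2 / c) \<le> J x" for x
  proof -
    have "0 \<le> (c * norm x - K)\<^sup>2 / c" using c by simp
    also have "\<dots> = c * (norm x)\<^sup>2 - 2 * (norm x * K) + K\<^sup>2 / c"
      using c by (simp add: power2_eq_square field_simps)
    also have "\<dots> \<le> J x + K\<^sup>2 / c"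
      using coercive[of x] K(1)[of x] by (simp add: J_def)
    finally show ?thesis by simp
  qed
  then have bdd: "bdd_below (range J)" by (intro bdd_belowI[of _ "- (K\<^sup>2 / c)"]) auto
  have J_ge: "m \<le> J x" for x unfolding m_def by (rule cInf_lower) (use bdd in auto)
  have "\<exists>x. J x < m + 1 / real (Suc n)" for n
  proof -
    have "Inf (range J) < m + 1 / real (Suc n)" by (simp add: m_def)
    then show ?thesis using cInf_lessD[of "range J"] by blast
  qed
  then obtain X where X: "\<And>n. J (X n) < m + 1 / real (Suc n)" by metis
  \<comment> \<open>Parallelogram identity: the midpoint has energy at least \<open>m\<close>, so
    two points of nearly minimal energy must be close.\<close>
  have half: "J x + J y - 2 * J ((1/2) *\<^sub>R (x + y)) = a (x - y) (x - y) / 2" for x y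
    by (simp add: J_def a.add_left a.add_right a.diff_left a.diff_right a.scaleR_left a.scaleR_right
        f.add f.scaleR sym[of y x] field_simps)
  have dist: "c * (norm (x - y))\<^sup>2 \<le> 2 * (J x + J y - 2 * m)" for x y
  proof -
    have "c * (norm (x - y))\<^sup>2 \<le> 2 * (J x + J y - 2 * J ((1/2) *\<^sub>R (x + y)))"
      unfolding half using coercive[of "x - y"] by simp
    also have "\<dots> \<le> 2 * (J x + J y - 2 * m)" using J_ge by simp
    finally show ?thesis .
  qed
  have "Cauchy X"
  proof (rule CauchyI)
    fix e :: real assume "0 < e"
    then obtain N where N: "4 / (c * e\<^sup>2) < real N" using reals_Archimedean2 by blast
    have "norm (X i - X j) < e" if "i \<ge> N" "j \<ge> N" for i j
    proof -
      have N0: "0 < real N" using N c \<open>0 < e\<close>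
        by (metis divide_pos_pos less_trans mult_pos_pos zero_less_numeral zero_less_power)
      have le: "1 / real (Suc k) \<le> 1 / real N" if "k \<ge> N" for k
        using that N0 by (intro divide_left_mono) auto
      have "J (X i) < m + 1 / real N" "J (X j) < m + 1 / real N"
        using X[of i] X[of j] le[OF that(1)] le[OF that(2)] by linarith+
      then have "2 * (J (X i) + J (X j) - 2 * m) < 4 * (1 / real N)" by argo
      with dist[of "X i" "X j"] have "c * (norm (X i - X j))\<^sup>2 < 4 / real N" by simp
      also have "\<dots> < c * e\<^sup>2"
        using N N0 c \<open>0 < e\<close> by (simp add: field_simps)
      finally show ?thesis using c \<open>0 < e\<close> by (simp add: power2_less_imp_less)
    qed
    then show "\<exists>M. \<forall>i\<ge>M. \<forall>j\<ge>M. norm (X i - X j) < e" by blast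
  qed
  then obtain u where u: "X \<longlonglongrightarrow> u" using Cauchy_convergent convergent_def by blast
  have "(\<lambda>n. J (X n)) \<longlonglongrightarrow> J u"
    unfolding J_def by (intro tendsto_intros a.tendsto f.tendsto u)
  moreover have "(\<lambda>n. m + 1 / real (Suc n)) \<longlonglongrightarrow> m + 0"
    by (intro tendsto_add tendsto_const LIMSEQ_Suc[OF lim_1_over_n])
  ultimately have "J u \<le> m + 0"
    by (rule LIMSEQ_le) (use X less_imp_le in blast)
  then have min: "J u \<le> J y" for y using J_ge[of y] by simp
  have "a x u = f x" for x
  proof (rule ccontr)
    assume ne: "a x u \<noteq> f x"
    define d where "d = a x u - f x"
    define b where "b = a x x"
    have pos: "0 \<le> 2 * s * d + s\<^sup>2 * b" for s
      using min[of "u + s *\<^sub>R x"] sym[of u x]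
      by (simp add: J_def d_def b_def a.add_left a.add_right a.scaleR_left a.scaleR_right
        f.add f.scaleR power2_eq_square algebra_simps)
    have "0 \<le> b" using coercive[of x] c by (simp add: b_def order_trans[rotated])
    \<comment> \<open>The step \<open>- d / b\<close> would be optimal; \<open>b + 1\<close> keeps
      the denominator positive when \<open>b = 0\<close> and still makes the energy drop.\<close>
    have "0 \<le> 2 * (- d / (b + 1)) * d + (- d / (b + 1))\<^sup>2 * b" by (rule pos)
    also have "\<dots> = (d / (b + 1))\<^sup>2 * (- b - 2)"
      using \<open>0 \<le> b\<close> by (simp add: power2_eq_square divide_simps) (simp add: algebra_simps)
    also have "\<dots> < 0" using \<open>0 \<le> b\<close> ne by (intro mult_pos_neg) (auto simp: d_def)
    finally show False by simp
  qed
  then show ?thesis by (rule that)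
qed

section \<open>Existence and uniqueness of the adjoint\<close>

lemma in_bounded_operators: "T \<in> bounded_operators \<longleftrightarrow> (\<forall>c x. T (c *\<^sub>C x) = c *\<^sub>C T x)"
  by (simp add: bounded_operators_def)

text \<open>By homogeneity the imaginary part at \<open>x\<close> is minus the real part at
  \<open>\<i> *\<^sub>C x\<close>.\<close>

lemma cinner_eq_iff_Re:
  fixes u v :: "'a::complex_inner \<Rightarrow> complex"
  assumes Re: "\<And>x. Re (u x) = Re (v x)"
    and "\<And>c x. u (c *\<^sub>C x) = c * u x" and "\<And>c x. v (c *\<^sub>C x) = c * v x"
  shows "u x = v x"
  using Re[of x] Re[of "\<i> *\<^sub>C x"] by (simp add: assms complex_eq_iff)

lemma cadjoint_eqI:
  assumes "\<And>x y. cinner (blinfun_apply T x) y = cinner x (blinfun_apply S y)"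
  shows "cadjoint T = S"
  unfolding cadjoint_def
proof (rule the_equality)
  fix R assume "\<forall>x y. cinner (blinfun_apply T x) y = cinner x (blinfun_apply R y)"
  then show "R = S" by (intro blinfun_eqI cinner_eqI) (simp add: assms[symmetric])
qed (use assms in simp)

text \<open>This is the existence half of the definite description. For each \<open>y\<close>, Riesz
  representation of the real functional \<open>Re (cinner (T x) y)\<close> gives the value at
  \<open>y\<close>; complex linearity of \<open>T\<close> then lifts the identity from real parts to
  complex values.\<close>

lemma cinner_cadjoint:
  fixes T :: "'a::complex_hilbert_space \<Rightarrow>\<^sub>L 'a"
  assumes T: "T \<in> bounded_operators"
  shows "cinner (T x) y = cinner x (cadjoint T y)"
proof -
  have "\<exists>u. \<forall>x. cinner (T x) y = cinner x u" for y
  proof -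
    have *: "bounded_bilinear (\<lambda>x y::'a. Re (cinner x y))"
      by (rule bounded_bilinear_Re_cinner)
    obtain u where u: "\<And>x. Re (cinner x u) = Re (cinner (T x) y)"
    proof (rule symmetric_Lax_Milgram[of "\<lambda>x y::'a. Re (cinner x y)" 1 "\<lambda>x. Re (cinner (T x) y)"])
      show "bounded_linear (\<lambda>x. Re (cinner (T x) y))"
        by (intro bounded_linear_compose[OF bounded_linear_Re]
            bounded_linear_compose[OF cinner.bounded_linear_left] blinfun.bounded_linear_right)
    qed (use * in \<open>auto simp: Re_cinner_self Re_cinner_commute\<close>)
    have "cinner (T x) y = cinner x u" for x
      using T by (intro cinner_eq_iff_Re[of "\<lambda>x. cinner (T x) y" "\<lambda>x. cinner x u"])
        (auto simp: u in_bounded_operators cinner_scaleC_left)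
    then show ?thesis by blast
  qed
  then obtain S where S: "\<And>x y. cinner (T x) y = cinner x (S y)" by metis
  have "bounded_linear S"
  proof (rule bounded_linear_intro)
    show "S (y + z) = S y + S z" for y z
      by (rule cinner_eqI) (simp add: S[symmetric] cinner_add_right)
    show "S (a *\<^sub>R y) = a *\<^sub>R S y" for a y
      by (rule cinner_eqI) (simp add: S[symmetric] cinner.scaleR_right)
    show "norm (S y) \<le> norm y * norm T" for y
    proof (cases "norm (S y) = 0")
      case False
      \<comment> \<open>The adjoint relation at the vector \<open>S y\<close> itself; one factor
        \<open>norm (S y)\<close> cancels afterwards.\<close>
      have "(norm (S y))\<^sup>2 = Re (cinner (T (S y)) y)" by (simp add: S Re_cinner_self)
      also have "\<dots> \<le> norm (T (S y)) * norm y" by (rule Re_cinner_le)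
      also have "\<dots> \<le> norm T * norm (S y) * norm y" by (intro mult_right_mono norm_blinfun) auto
      finally show ?thesis using False by (simp add: power2_eq_square mult.commute mult.left_commute)
    qed (simp only: mult_nonneg_nonneg norm_ge_zero)
  qed
  then have "cadjoint T = Blinfun S"
    by (intro cadjoint_eqI) (simp add: bounded_linear_Blinfun_apply S)
  then show ?thesis by (simp add: bounded_linear_Blinfun_apply \<open>bounded_linear S\<close> S)
qed

section \<open>Bounded operators and invertibility\<close>

lemma bounded_operatorsD: "T \<in> bounded_operators \<Longrightarrow> T (c *\<^sub>C x) = c *\<^sub>C T x"
  by (simp add: in_bounded_operators)

lemma bounded_operators_zero [simp]: "0 \<in> bounded_operators"
  by (simp add: in_bounded_operators)

lemma bounded_operators_add [simp]:
  "S \<in> bounded_operators \<Longrightarrow> T \<in> bounded_operators \<Longrightarrow> S + T \<in> bounded_operators"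
  by (simp add: in_bounded_operators blinfun.add_left scaleC_add_right)

lemma bounded_operators_diff [simp]:
  "S \<in> bounded_operators \<Longrightarrow> T \<in> bounded_operators \<Longrightarrow> S - T \<in> bounded_operators"
  by (simp add: in_bounded_operators blinfun.diff_left scaleC.diff_right)

lemma bounded_operators_scaleR [simp]:
  "T \<in> bounded_operators \<Longrightarrow> a *\<^sub>R T \<in> bounded_operators"
  by (simp add: in_bounded_operators blinfun.scaleR_left scaleC_scaleR)

lemma bounded_operators_compose [simp]:
  "S \<in> bounded_operators \<Longrightarrow> T \<in> bounded_operators \<Longrightarrow> S o\<^sub>L T \<in> bounded_operators"
  by (simp add: in_bounded_operators)

lemma bounded_operators_cadjoint [simp]:
  assumes "T \<in> bounded_operators"
  shows "cadjoint T \<in> bounded_operators"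
proof -
  have "cadjoint T (c *\<^sub>C y) = c *\<^sub>C cadjoint T y" for c y
    by (rule cinner_eqI)
      (simp add: cinner_cadjoint[OF assms, symmetric] cinner_scaleC_right)
  then show ?thesis by (simp add: in_bounded_operators)
qed

lemma cinner_cadjoint_left:
  "T \<in> bounded_operators \<Longrightarrow> cinner (cadjoint T x) y = cinner x (T y)"
  by (metis cinner_cadjoint cinner_commute)

lemma bounded_operators_limit:
  assumes "\<And>n. f n \<in> bounded_operators" and "f \<longlonglongrightarrow> T"
  shows "T \<in> bounded_operators"
proof -
  have "T (c *\<^sub>C x) = c *\<^sub>C T x" for c x
  proof (rule LIMSEQ_unique)
    show "(\<lambda>n. f n (c *\<^sub>C x)) \<longlonglongrightarrow> T (c *\<^sub>C x)"
      by (intro blinfun.tendsto assms tendsto_const)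
    have "(\<lambda>n. c *\<^sub>C f n x) \<longlonglongrightarrow> c *\<^sub>C T x"
      by (intro scaleC.tendsto blinfun.tendsto assms tendsto_const)
    then show "(\<lambda>n. f n (c *\<^sub>C x)) \<longlonglongrightarrow> c *\<^sub>C T x"
      by (simp add: bounded_operatorsD[OF assms(1)])
  qed
  then show ?thesis by (simp add: in_bounded_operators)
qed

text \<open>The operator type has only real scalar multiples, so the shift \<open>A - z I\<close>
  needs \<open>z I\<close> as an operator in its own right.\<close>

definition scalar_op :: "complex \<Rightarrow> 'a \<Rightarrow>\<^sub>L 'a::complex_inner"
  where "scalar_op c = Blinfun (scaleC c)"

lemma scalar_op_apply [simp]: "scalar_op c x = c *\<^sub>C x"
  by (simp add: scalar_op_def bounded_linear_Blinfun_apply scaleC.bounded_linear_right)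

lemma bounded_operators_scalar_op [simp]: "scalar_op c \<in> bounded_operators"
  by (simp add: in_bounded_operators scaleC_scaleC mult.commute)

definition invertible_op :: "('a::complex_inner \<Rightarrow>\<^sub>L 'a) \<Rightarrow> bool"
  where "invertible_op B \<longleftrightarrow> (\<exists>S\<in>bounded_operators. \<forall>x. blinfun_apply S (blinfun_apply B x) = x \<and> blinfun_apply B (blinfun_apply S x) = x)"

lemma op_spectrum_iff: "z \<in> op_spectrum A \<longleftrightarrow> \<not> invertible_op (A - scalar_op z)"
  by (simp add: op_spectrum_def invertible_op_def blinfun.diff_left)

lemma invertible_op_compose:
  assumes "invertible_op A" "invertible_op B"
  shows "invertible_op (A o\<^sub>L B)"
proof -
  obtain S where S: "S \<in> bounded_operators" "\<And>x. S (A x) = x" "\<And>x. A (S x) = x"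
    using assms(1) by (auto simp: invertible_op_def)
  obtain R where R: "R \<in> bounded_operators" "\<And>x. R (B x) = x" "\<And>x. B (R x) = x"
    using assms(2) by (auto simp: invertible_op_def)
  show ?thesis unfolding invertible_op_def
    by (rule bexI[of _ "R o\<^sub>L S"]) (simp_all add: S R)
qed

lemma invertible_op_scalar_op:
  assumes "c \<noteq> 0"
  shows "invertible_op (scalar_op c)"
  unfolding invertible_op_def
  by (rule bexI[of _ "scalar_op (1 / c)"]) (simp_all add: assms scaleC_scaleC)

lemma invertible_op_bounded_below:
  assumes "invertible_op B"
  obtains c where "0 < c" "\<And>x. c * norm x \<le> norm (B x)"
proof -
  obtain S where "S \<in> bounded_operators" and S: "\<And>x. S (B x) = x"
    using assms by (auto simp: invertible_op_def)
  have "norm x \<le> (norm S + 1) * norm (B x)" for x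
    using norm_blinfun[of S "B x"] by (simp add: S distrib_right add_increasing2)
  then have "1 / (norm S + 1) * norm x \<le> norm (B x)" for x
    by (simp add: add_nonneg_pos pos_divide_le_eq mult.commute)
  then show ?thesis by (rule that[rotated]) (simp add: add_nonneg_pos)
qed

text \<open>The lower bound gives injectivity and at the same time the bound \<open>1 / c\<close>
  for the inverse.\<close>

lemma invertible_opI:
  assumes B: "B \<in> bounded_operators" and c: "0 < c" "\<And>x. c * norm x \<le> norm (B x)"
    and surj: "surj (blinfun_apply B)"
  shows "invertible_op B"
proof -
  have inj: "x = y" if "B x = B y" for x y
  proof -
    have "c * norm (x - y) \<le> 0" using c(2)[of "x - y"] by (simp add: blinfun.diff_right that)
    then show ?thesis using c(1) by (simp add: mult_le_0_iff)
  qed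
  define S where "S = inv (blinfun_apply B)"
  have BS: "B (S x) = x" for x by (simp add: S_def surj surj_f_inv_f)
  have SB: "S (B x) = x" for x by (rule inj) (simp add: BS)
  have "bounded_linear S"
  proof (rule bounded_linear_intro)
    show "S (x + y) = S x + S y" for x y by (rule inj) (simp add: BS blinfun.add_right)
    show "S (a *\<^sub>R x) = a *\<^sub>R S x" for a x by (rule inj) (simp add: BS blinfun.scaleR_right)
    show "norm (S x) \<le> norm x * (1 / c)" for x
      using c(2)[of "S x"] c(1) by (simp add: BS field_simps)
  qed
  moreover have "S (a *\<^sub>C x) = a *\<^sub>C S x" for a x
    by (rule inj) (simp add: BS bounded_operatorsD[OF B])
  ultimately show ?thesis unfolding invertible_op_def
    by (intro bexI[of _ "Blinfun S"])
      (auto simp: in_bounded_operators bounded_linear_Blinfun_apply BS SB)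
qed

section \<open>The spectrum of a self-adjoint operator\<close>

definition selfadjoint_op :: "('a::complex_hilbert_space \<Rightarrow>\<^sub>L 'a) \<Rightarrow> bool"
  where "selfadjoint_op A \<longleftrightarrow> A \<in> bounded_operators \<and>
    (\<forall>x y. cinner (blinfun_apply A x) y = cinner x (blinfun_apply A y))"

lemma selfadjoint_opD:
  assumes "selfadjoint_op A"
  shows "A \<in> bounded_operators" "cinner (A x) y = cinner x (A y)"
  using assms by (auto simp: selfadjoint_op_def)

lemma selfadjoint_Im_cinner:
  assumes "selfadjoint_op A"
  shows "Im (cinner (A x) x) = 0"
  using selfadjoint_opD(2)[OF assms, of x x] cinner_commute[of x "A x"]
  by (simp add: complex_eq_iff)

text \<open>Pythagoras: since \<open>cinner (A x) x\<close> is real,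
  \<open>A x - Re z *\<^sub>R x\<close> has inner product with \<open>\<i> *\<^sub>C x\<close> of
  vanishing real part.\<close>

lemma norm_selfadjoint_shift:
  assumes A: "selfadjoint_op A"
  shows "(norm (A x - z *\<^sub>C x))\<^sup>2 =
    (norm (A x - Re z *\<^sub>R x))\<^sup>2 + (Im z)\<^sup>2 * (norm x)\<^sup>2"
proof -
  have z: "z *\<^sub>C x = Re z *\<^sub>R x + Im z *\<^sub>R (\<i> *\<^sub>C x)"
    by (subst complex_eq[of z])
      (simp add: scaleC_add_left scaleR_eq_scaleC scaleC_scaleC mult.commute)
  have "Re (cinner (A x - Re z *\<^sub>R x) (\<i> *\<^sub>C x)) = 0"
    using selfadjoint_Im_cinner[OF A, of x]
    by (simp add: cinner_scaleC_right cinner.diff_left cinner.scaleR_left cinner_self)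
  then show ?thesis
    using norm_add_sqr[of "A x - Re z *\<^sub>R x" "- (Im z *\<^sub>R (\<i> *\<^sub>C x))"]
    by (simp add: z cinner.minus_right cinner.scaleR_right power_mult_distrib algebra_simps)
qed

text \<open>\<open>B = A - z I\<close> commutes with its adjoint \<open>B'\<close>. The lower bound
  makes the form of \<open>B' B\<close> coercive, so \<open>B' (B u) = y\<close> is solvable, and
  commuting turns this into \<open>B (B' u) = y\<close>, hence surjectivity.\<close>

lemma op_spectrum_selfadjoint_bounded_below:
  assumes A: "selfadjoint_op A" and c: "0 < c" "\<And>x. c * norm x \<le> norm (A x - z *\<^sub>C x)"
  shows "z \<notin> op_spectrum A"
proof -
  note [simp] = selfadjoint_opD(1)[OF A]
  define B where "B = A - scalar_op z"
  define B' where "B' = A - scalar_op (cnj z)"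
  have Bx: "B x = A x - z *\<^sub>C x" and B'x: "B' x = A x - cnj z *\<^sub>C x" for x
    by (simp_all add: B_def B'_def blinfun.diff_left)
  have adj: "cinner (B x) y = cinner x (B' y)" for x y
    by (simp add: Bx B'x cinner.diff_left cinner.diff_right cinner_scaleC_left cinner_scaleC_right
        selfadjoint_opD(2)[OF A])
  have comm: "B' (B x) = B (B' x)" for x
    by (simp add: Bx B'x blinfun.diff_right scaleC.diff_right bounded_operatorsD scaleC_scaleC mult.commute)
  have B: "B \<in> bounded_operators" by (simp add: B_def)
  have "\<exists>v. B v = y" for y
  proof -
    obtain u where u: "\<And>x. Re (cinner (B x) (B u)) = Re (cinner x y)"
    proof (rule symmetric_Lax_Milgram[of "\<lambda>x y. Re (cinner (B x) (B y))" "c\<^sup>2" "\<lambda>x. Re (cinner x y)"])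
      show "bounded_bilinear (\<lambda>x y. Re (cinner (B x) (B y)))"
        by (rule bounded_bilinear.comp[OF bounded_bilinear_Re_cinner
            blinfun.bounded_linear_right blinfun.bounded_linear_right])
      show "bounded_linear (\<lambda>x. Re (cinner x y))"
        by (rule bounded_bilinear.bounded_linear_left[OF bounded_bilinear_Re_cinner])
      show "c\<^sup>2 * (norm x)\<^sup>2 \<le> Re (cinner (B x) (B x))" for x
        using c power_mono[OF c(2)[of x], of 2] by (simp add: Re_cinner_self Bx power_mult_distrib)
    qed (use c in \<open>auto simp: Re_cinner_commute\<close>)
    have "B' (B u) = y" by (rule cinner_eqI) (simp add: adj[symmetric] u)
    then show ?thesis by (auto simp: comm)
  qed
  then have "surj (blinfun_apply B)" by (metis surjI)
  then have "invertible_op B" using B c(1) by (rule_tac invertible_opI) (use c in \<open>auto simp: Bx\<close>)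
  then show ?thesis by (simp add: op_spectrum_iff B_def)
qed

lemma not_in_op_spectrumE:
  assumes "z \<notin> op_spectrum A"
  obtains c where "0 < c" "\<And>x. c * norm x \<le> norm (A x - z *\<^sub>C x)"
proof -
  have "invertible_op (A - scalar_op z)" using assms by (simp add: op_spectrum_iff)
  then show ?thesis
    by (rule invertible_op_bounded_below) (rule that, simp_all add: blinfun.diff_left)
qed

lemma op_spectrum_selfadjoint_real:
  assumes "selfadjoint_op A" "z \<in> op_spectrum A"
  shows "Im z = 0"
proof (rule ccontr)
  assume "Im z \<noteq> 0"
  have "\<bar>Im z\<bar> * norm x \<le> norm (A x - z *\<^sub>C x)" for x
    by (rule power2_le_imp_le)
      (simp_all add: norm_selfadjoint_shift[OF assms(1)] power_mult_distrib)
  then show False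
    using op_spectrum_selfadjoint_bounded_below[OF assms(1), of "\<bar>Im z\<bar>" z] assms(2) \<open>Im z \<noteq> 0\<close> by simp
qed

lemma op_spectrum_selfadjoint_norm:
  assumes "selfadjoint_op A" "z \<in> op_spectrum A"
  shows "cmod z \<le> norm A"
proof (rule ccontr)
  assume *: "\<not> cmod z \<le> norm A"
  have "(cmod z - norm A) * norm x \<le> norm (A x - z *\<^sub>C x)" for x
    using norm_triangle_ineq2[of "z *\<^sub>C x" "A x"] norm_blinfun[of A x]
    by (simp add: left_diff_distrib norm_minus_commute)
  then show False
    using op_spectrum_selfadjoint_bounded_below[OF assms(1), of "cmod z - norm A" z] assms(2) * by simp
qed

text \<open>The complement is open because a lower bound \<open>c\<close> at \<open>z\<close> leaves
  \<open>c / 2\<close> after a move of less than \<open>c / 2\<close>.\<close>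

lemma compact_op_spectrum:
  assumes A: "selfadjoint_op A"
  shows "compact (op_spectrum A)"
proof -
  have "bounded (op_spectrum A)"
    using op_spectrum_selfadjoint_norm[OF A] by (auto simp: bounded_iff)
  moreover have "closed (op_spectrum A)"
    unfolding closed_def open_dist
  proof
    fix z assume "z \<in> - op_spectrum A"
    then obtain c where c: "0 < c" "\<And>x. c * norm x \<le> norm (A x - z *\<^sub>C x)"
      using not_in_op_spectrumE by blast
    have "w \<in> - op_spectrum A" if w: "dist w z < c / 2" for w
    proof -
      have "c / 2 * norm x \<le> norm (A x - w *\<^sub>C x)" for x
      proof -
        have eq: "A x - z *\<^sub>C x = (A x - w *\<^sub>C x) + (w - z) *\<^sub>C x" by (simp add: scaleC.diff_left)
        have "norm (A x - z *\<^sub>C x) \<le> norm (A x - w *\<^sub>C x) + cmod (w - z) * norm x"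
          unfolding eq using norm_triangle_ineq[of "A x - w *\<^sub>C x" "(w - z) *\<^sub>C x"] by simp
        moreover have "cmod (w - z) * norm x \<le> c / 2 * norm x"
          using w by (intro mult_right_mono) (auto simp: dist_norm)
        ultimately show ?thesis using c(2)[of x] by (simp add: field_simps)
      qed
      then show ?thesis using op_spectrum_selfadjoint_bounded_below[OF A, of "c / 2" w] c(1) by simp
    qed
    then show "\<exists>e>0. \<forall>y. dist y z < e \<longrightarrow> y \<in> - op_spectrum A"
      using c(1) by (intro exI[of _ "c / 2"]) auto
  qed
  ultimately show ?thesis by (simp add: compact_eq_bounded_closed)
qed

text \<open>If neither \<open>m\<close> nor \<open>- m\<close> were spectral for
  \<open>m = norm A\<close>, then \<open>A A - m\<^sup>2 I\<close> would be bounded below. But it is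
  small on vectors where \<open>A\<close> nearly attains its norm, so the norm of \<open>A\<close>
  would be strictly below \<open>m\<close>.\<close>

lemma norm_in_op_spectrum:
  assumes A: "selfadjoint_op A" and "A \<noteq> 0"
  obtains n where "n \<in> op_spectrum A" "cmod n = norm A"
proof (rule ccontr)
  assume "\<not> thesis"
  note obt = that
  have no: "n \<notin> op_spectrum A" if "cmod n = norm A" for n
    using \<open>\<not> thesis\<close> obt that by blast
  define m where "m = norm A"
  have m: "0 < m" using \<open>A \<noteq> 0\<close> by (simp add: m_def)
  have "complex_of_real m \<notin> op_spectrum A" "complex_of_real (- m) \<notin> op_spectrum A"
    by (rule no, simp add: m_def)+
  then obtain c d where c: "0 < c" "\<And>x. c * norm x \<le> norm (A x - complex_of_real m *\<^sub>C x)"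
    and d: "0 < d" "\<And>x. d * norm x \<le> norm (A x - complex_of_real (- m) *\<^sub>C x)"
    by (metis not_in_op_spectrumE)
  \<comment> \<open>The factorisation of \<open>A A - m\<^sup>2 I\<close> into
    \<open>A - m I\<close> and \<open>A + m I\<close>; the two lower bounds multiply.\<close>
  have low: "c * d * norm x \<le> norm (A (A x) - m\<^sup>2 *\<^sub>R x)" for x
  proof -
    have "c * d * norm x \<le> c * norm (A x + m *\<^sub>R x)"
      using c(1) d(2)[of x] by (simp add: scaleR_eq_scaleC[symmetric] mult.assoc flip: of_real_minus)
    also have "\<dots> \<le> norm (A (A x + m *\<^sub>R x) - m *\<^sub>R (A x + m *\<^sub>R x))"
      using c(2)[of "A x + m *\<^sub>R x"] by (simp add: scaleR_eq_scaleC[symmetric])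
    finally show ?thesis
      by (simp add: blinfun.add_right blinfun.scaleR_right algebra_simps power2_eq_square)
  qed
  have up: "(norm (A (A x) - m\<^sup>2 *\<^sub>R x))\<^sup>2 \<le> 2 * m\<^sup>2 * (m\<^sup>2 * (norm x)\<^sup>2 - (norm (A x))\<^sup>2)" for x
  proof -
    have "Re (cinner (A (A x)) x) = (norm (A x))\<^sup>2"
      by (simp add: selfadjoint_opD(2)[OF A, of "A x" x] Re_cinner_self)
    then have "(norm (A (A x) - m\<^sup>2 *\<^sub>R x))\<^sup>2 =
        (norm (A (A x)))\<^sup>2 - 2 * m\<^sup>2 * (norm (A x))\<^sup>2 + (m\<^sup>2)\<^sup>2 * (norm x)\<^sup>2"
      using norm_add_sqr[of "A (A x)" "- (m\<^sup>2 *\<^sub>R x)"]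
      by (simp add: cinner.minus_right cinner.scaleR_right power_mult_distrib)
    moreover have "(norm (A (A x)))\<^sup>2 \<le> m\<^sup>2 * (norm (A x))\<^sup>2"
      using power_mono[OF norm_blinfun[of A "A x"], of 2] by (simp add: m_def power_mult_distrib)
    moreover have "m\<^sup>2 * (norm (A x))\<^sup>2 \<le> m\<^sup>2 * (m\<^sup>2 * (norm x)\<^sup>2)"
      using power_mono[OF norm_blinfun[of A x], of 2]
      by (intro mult_left_mono) (simp_all add: m_def power_mult_distrib)
    ultimately show ?thesis by (simp add: algebra_simps power2_eq_square)
  qed
  \<comment> \<open>The loss obtained by comparing \<open>low\<close> with \<open>up\<close> and
    dividing by \<open>2 * m\<^sup>2\<close>.\<close>
  define e where "e = (c * d)\<^sup>2 / (2 * m\<^sup>2)"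
  have e: "0 < e" using c(1) d(1) m by (simp add: e_def)
  have key: "(norm (A x))\<^sup>2 \<le> (m\<^sup>2 - e) * (norm x)\<^sup>2" for x
  proof -
    have "(c * d)\<^sup>2 * (norm x)\<^sup>2 \<le> (norm (A (A x) - m\<^sup>2 *\<^sub>R x))\<^sup>2"
      using power_mono[OF low[of x], of 2] c(1) d(1) by (simp add: power_mult_distrib)
    with up[of x] have "(c * d)\<^sup>2 * (norm x)\<^sup>2 \<le> 2 * m\<^sup>2 * (m\<^sup>2 * (norm x)\<^sup>2 - (norm (A x))\<^sup>2)"
      by linarith
    then show ?thesis using m by (simp add: e_def field_simps)
  qed
  \<comment> \<open>A vector outside the kernel shows that \<open>m\<^sup>2 - e\<close> is not
    negative, so its square root can serve as an operator bound.\<close>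
  obtain y where y: "A y \<noteq> 0" using \<open>A \<noteq> 0\<close> by (metis blinfun_eqI blinfun.zero_left)
  then have "0 < (m\<^sup>2 - e) * (norm y)\<^sup>2" using key[of y] by (simp add: less_le_trans[rotated])
  then have pos: "0 \<le> m\<^sup>2 - e" by (simp add: zero_less_mult_iff)
  have "norm (A x) \<le> sqrt (m\<^sup>2 - e) * norm x" for x
    by (rule power2_le_imp_le) (use key[of x] pos in \<open>simp_all add: power_mult_distrib\<close>)
  then have "m \<le> sqrt (m\<^sup>2 - e)" unfolding m_def
    by (intro norm_blinfun_bound) (use pos in \<open>simp_all add: m_def\<close>)
  then have "m\<^sup>2 \<le> (sqrt (m\<^sup>2 - e))\<^sup>2" using m by (intro power_mono) auto
  then show False using e pos by simp
qed

section \<open>Polynomials of a self-adjoint operator\<close>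

text \<open>Horner's scheme, which lets the algebraic laws be proved by induction on
  \<open>pCons\<close>.\<close>

definition poly_op :: "('a::complex_hilbert_space \<Rightarrow>\<^sub>L 'a) \<Rightarrow> complex poly \<Rightarrow> ('a \<Rightarrow>\<^sub>L 'a)"
  where "poly_op A p = fold_coeffs (\<lambda>a B. scalar_op a + (A o\<^sub>L B)) p 0"

lemma scalar_op_0 [simp]: "scalar_op 0 = 0"
  by (rule blinfun_eqI) (simp add: scaleC.zero_left)

lemma poly_op_0 [simp]: "poly_op A 0 = 0"
  by (simp add: poly_op_def)

lemma poly_op_pCons [simp]: "poly_op A (pCons a p) = scalar_op a + (A o\<^sub>L poly_op A p)"
  by (cases "p = 0 \<and> a = 0") (auto simp: poly_op_def fold_coeffs_pCons_not_0_0_eq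
      fold_coeffs_pCons_coeff_not_0_eq blinfun_eqI blinfun.add_left)

lemma bounded_operators_poly_op [simp]:
  "A \<in> bounded_operators \<Longrightarrow> poly_op A p \<in> bounded_operators"
  by (induction p) auto

lemma poly_op_add: "poly_op A (p + q) = poly_op A p + poly_op A q"
  by (induction p q rule: poly_induct2)
    (auto intro!: blinfun_eqI simp: blinfun.add_left blinfun.add_right scaleC_add_left)

lemma poly_op_smult:
  assumes "A \<in> bounded_operators"
  shows "poly_op A (smult c p) = scalar_op c o\<^sub>L poly_op A p"
  by (induction p) (auto intro!: blinfun_eqI
      simp: blinfun.add_left scaleC_add_right scaleC_scaleC bounded_operatorsD[OF assms] scaleC.zero_right)

lemma poly_op_diff:
  assumes "A \<in> bounded_operators"
  shows "poly_op A (p - q) = poly_op A p - poly_op A q"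
  using poly_op_add[of A "p - q" q] by (simp add: algebra_simps)

lemma poly_op_mult:
  assumes "A \<in> bounded_operators"
  shows "poly_op A (p * q) = poly_op A p o\<^sub>L poly_op A q"
  by (induction p) (auto intro!: blinfun_eqI
      simp: blinfun.add_left poly_op_add poly_op_smult[OF assms] scaleC.zero_left)

lemma poly_op_commute:
  assumes "A \<in> bounded_operators"
  shows "poly_op A p (A x) = A (poly_op A p x)"
  by (induction p) (auto simp: blinfun.add_left blinfun.add_right bounded_operatorsD[OF assms])

lemma cinner_poly_op:
  assumes A: "selfadjoint_op A"
  shows "cinner (poly_op A p x) y = cinner x (poly_op A (map_poly cnj p) y)"
proof (induction p arbitrary: y)
  case (pCons a p)
  then show ?case
    by (simp add: map_poly_pCons blinfun.add_left cinner_add_left cinner_add_right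
        cinner_scaleC_left cinner_scaleC_right selfadjoint_opD(2)[OF A] poly_op_commute selfadjoint_opD(1)[OF A])
qed simp

text \<open>The half of the spectral mapping theorem that needs the fundamental theorem of algebra:
  a root outside the spectrum splits off an invertible linear factor, so the quotient of lower
  degree is again not invertible. Nonemptiness of the spectrum serves the zero polynomial, the only
  constant that can occur.\<close>

lemma poly_op_not_invertible_root:
  assumes A: "A \<in> bounded_operators" and ne: "op_spectrum A \<noteq> {}"
    and "\<not> invertible_op (poly_op A q)"
  shows "\<exists>z\<in>op_spectrum A. poly q z = 0"
  using assms(3)
proof (induction "degree q" arbitrary: q rule: less_induct)
  case less
  show ?case
  proof (cases "degree q = 0")
    case True
    then obtain c where q: "q = [:c:]" by (rule degree_eq_zeroE)
    then have "c = 0" using less.prems invertible_op_scalar_op[of c] by auto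
    then show ?thesis using ne q by auto
  next
    case False
    then obtain z where z: "poly q z = 0"
      using fundamental_theorem_of_algebra[of q] constant_degree[of q] by auto
    then obtain s where s: "q = [:- z, 1:] * s" by (metis dvdE poly_eq_0_iff_dvd)
    then have "s \<noteq> 0" using False by auto
    then have "degree q = degree [:- z, 1:] + degree s"
      unfolding s by (intro degree_mult_eq) auto
    then have deg: "degree s < degree q" by simp
    have eq: "poly_op A q = (A - scalar_op z) o\<^sub>L poly_op A s"
      unfolding s poly_op_mult[OF A]
      by (rule blinfun_eqI) (simp add: blinfun.add_left blinfun.diff_left scaleC.minus_left scaleC.zero_left blinfun.zero_right)
    show ?thesis
    proof (cases "z \<in> op_spectrum A")
      case False
      then have "\<not> invertible_op (poly_op A s)"
        using less.prems invertible_op_compose unfolding eq op_spectrum_iff by blast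
      then show ?thesis using less.hyps[OF deg] by (auto simp: s)
    qed (use z in blast)
  qed
qed

text \<open>With \<open>B\<close> the product of \<open>p(A)\<close> and its adjoint, the squared
  norm of \<open>p(A) x\<close> equals \<open>qform B x\<close>. The norm of \<open>B\<close> is the
  modulus of a spectral value of \<open>B\<close>, and spectral mapping traces that value back to
  the squared modulus of \<open>poly p z\<close> at a point \<open>z\<close> of the spectrum of
  \<open>A\<close>.\<close>

lemma norm_poly_op_le:
  assumes A: "selfadjoint_op A" and M: "0 \<le> M" "\<And>z. z \<in> op_spectrum A \<Longrightarrow> cmod (poly p z) \<le> M"
  shows "norm (poly_op A p) \<le> M"
proof -
  note bA = selfadjoint_opD(1)[OF A]
  define q where "q = map_poly cnj p * p"
  define B where "B = poly_op A q"
  have B: "cinner (B x) y = cinner (poly_op A p x) (poly_op A p y)" for x y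
  proof -
    have "cinner (poly_op A p x) (poly_op A p y) = cnj (cinner (poly_op A p y) (poly_op A p x))"
      by (rule cinner_commute)
    also have "\<dots> = cinner (B x) y"
      by (simp add: cinner_poly_op[OF A] B_def q_def poly_op_mult[OF bA] cinner_commute[symmetric])
    finally show ?thesis by simp
  qed
  have saB: "selfadjoint_op B"
    unfolding selfadjoint_op_def
  proof (intro conjI allI)
    show "B \<in> bounded_operators" by (simp add: B_def bA)
    fix x y
    have "cinner x (B y) = cnj (cinner (B y) x)" by (rule cinner_commute)
    also have "\<dots> = cinner (B x) y" unfolding B by (rule cinner_commute[symmetric])
    finally show "cinner (B x) y = cinner x (B y)" by simp
  qed
  have "norm B \<le> M\<^sup>2"
  proof (cases "B = 0")
    case False
    obtain n where n: "n \<in> op_spectrum B" "cmod n = norm B"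
      using norm_in_op_spectrum[OF saB False] by blast
    \<comment> \<open>For \<open>A = 0\<close> the norm argument says nothing; but
      \<open>B \<noteq> 0\<close> forces a nonzero space, on which the zero operator is not
      invertible.\<close>
    have "op_spectrum A \<noteq> {}"
    proof (cases "A = 0")
      case True
      have "\<not> invertible_op (0 :: 'a \<Rightarrow>\<^sub>L 'a)"
      proof
        assume "invertible_op (0 :: 'a \<Rightarrow>\<^sub>L 'a)"
        then have "x = 0" for x :: 'a by (auto simp: invertible_op_def)
        then have "B i = (0 :: 'a \<Rightarrow>\<^sub>L 'a) i" for i by metis
        then show False using False blinfun_eqI by blast
      qed
      then have "0 \<in> op_spectrum A" by (simp add: op_spectrum_iff True)
      then show ?thesis by auto
    qed (metis A norm_in_op_spectrum empty_iff)
    moreover have "poly_op A (q - [:n:]) = B - scalar_op n"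
      by (simp add: poly_op_diff[OF bA] B_def)
    then have "\<not> invertible_op (poly_op A (q - [:n:]))"
      using n(1) by (simp add: op_spectrum_iff)
    ultimately obtain z where z: "z \<in> op_spectrum A" "poly q z = n"
      using poly_op_not_invertible_root[OF bA] by fastforce
    \<comment> \<open>At a real point, conjugating the coefficients conjugates the value; this turns
      \<open>q\<close> into the squared modulus of \<open>p\<close>.\<close>
    have "cnj z = z" using op_spectrum_selfadjoint_real[OF A z(1)] by (simp add: complex_eq_iff)
    then have "poly (map_poly cnj p) z = cnj (poly p z)" by (metis poly_cnj)
    then have "n = cnj (poly p z) * poly p z" using z(2) by (simp add: q_def)
    then have "norm B = (cmod (poly p z))\<^sup>2" by (simp add: n(2)[symmetric] norm_mult power2_eq_square)
    also have "\<dots> \<le> M\<^sup>2" using M(2)[OF z(1)] by (intro power_mono) auto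
    finally show ?thesis .
  qed simp
  have "norm (poly_op A p x) \<le> M * norm x" for x
  proof (rule power2_le_imp_le)
    have "(norm (poly_op A p x))\<^sup>2 = Re (cinner (B x) x)" by (simp add: B Re_cinner_self)
    also have "\<dots> \<le> norm (B x) * norm x" by (rule Re_cinner_le)
    also have "\<dots> \<le> norm B * norm x * norm x" by (intro mult_right_mono norm_blinfun) auto
    also have "\<dots> \<le> M\<^sup>2 * norm x * norm x" by (intro mult_right_mono \<open>norm B \<le> M\<^sup>2\<close>) auto
    finally show "(norm (poly_op A p x))\<^sup>2 \<le> (M * norm x)\<^sup>2" by (simp add: power2_eq_square mult_ac)
  qed (use M in simp)
  then show ?thesis using M(1) by (intro norm_blinfun_bound)
qed

section \<open>The continuous functional calculus\<close>

text \<open>Weierstrass approximation of real and imaginary part separately. The set is arbitrary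
  because the lemma serves both a single spectrum and an interval containing a whole family of
  spectra.\<close>

lemma uniform_limit_poly_real:
  fixes X :: "complex set"
  assumes X: "compact X" "\<And>z. z \<in> X \<Longrightarrow> Im z = 0" and f: "continuous_on X f"
  obtains P where "uniform_limit X (\<lambda>n. poly (P n)) f sequentially"
proof -
  define S where "S = Re ` X"
  have eq: "complex_of_real (Re z) = z" if "z \<in> X" for z
    using X(2)[OF that] by (simp add: complex_eq_iff)
  have S: "compact S" unfolding S_def
    by (intro compact_continuous_image X(1) continuous_intros)
  have "of_real ` S = X" by (auto simp: S_def eq image_iff intro!: bexI)
  then have g: "continuous_on S (\<lambda>t. f (complex_of_real t))"
    by (intro continuous_on_compose2[OF f] continuous_intros) auto
  have approx: "\<exists>p. \<forall>z\<in>X. cmod (poly p z - complex_of_real (h (f z))) < e"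
    if h: "h = Re \<or> h = Im" and "e > 0" for h and e :: real
  proof -
    have "continuous_on S (\<lambda>t. h (f (complex_of_real t)))"
      using h by (auto intro!: continuous_intros g)
    then obtain g where g: "real_polynomial_function g"
      "\<And>t. t \<in> S \<Longrightarrow> \<bar>h (f (complex_of_real t)) - g t\<bar> < e"
      using Stone_Weierstrass_real_polynomial_function[OF S _ \<open>e > 0\<close>] by blast
    obtain a n where an: "g = (\<lambda>t. \<Sum>i\<le>n. a i * t ^ i)"
      using g(1) real_polynomial_function_iff_sum by blast
    define p where "p = (\<Sum>i\<le>n. monom (complex_of_real (a i)) i)"
    have p: "poly p (complex_of_real t) = complex_of_real (g t)" for t
      by (simp add: p_def an poly_sum poly_monom)
    have "cmod (poly p z - complex_of_real (h (f z))) < e" if "z \<in> X" for z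
      using g(2)[of "Re z"] p[of "Re z"] that eq[OF that]
      by (simp add: S_def norm_minus_commute flip: of_real_diff)
    then show ?thesis by blast
  qed
  have "\<exists>p. \<forall>z\<in>X. cmod (poly p z - f z) < e" if "e > 0" for e :: real
  proof -
    have e2: "0 < e / 2" using that by simp
    obtain p where p: "\<And>z. z\<in>X \<Longrightarrow> cmod (poly p z - complex_of_real (Re (f z))) < e / 2"
      using approx[OF _ e2, of Re] by auto
    obtain q where q: "\<And>z. z\<in>X \<Longrightarrow> cmod (poly q z - complex_of_real (Im (f z))) < e / 2"
      using approx[OF _ e2, of Im] by auto
    have "cmod (poly (p + smult \<i> q) z - f z) < e" if z: "z \<in> X" for z
    proof -
      have "poly (p + smult \<i> q) z - f z =
          (poly p z - complex_of_real (Re (f z))) + \<i> * (poly q z - complex_of_real (Im (f z)))"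
        by (simp add: complex_eq_iff)
      then have "cmod (poly (p + smult \<i> q) z - f z) \<le>
          cmod (poly p z - complex_of_real (Re (f z))) + cmod (poly q z - complex_of_real (Im (f z)))"
        by (metis norm_triangle_ineq norm_mult norm_ii mult_1)
      then show ?thesis using p[OF z] q[OF z] by simp
    qed
    then show ?thesis by blast
  qed
  then have "\<forall>n. \<exists>p. \<forall>z\<in>X. cmod (poly p z - f z) < inverse (real (Suc n))"
    by simp
  then obtain P where P: "\<And>n z. z \<in> X \<Longrightarrow> cmod (poly (P n) z - f z) < inverse (real (Suc n))"
    by metis
  have "uniform_limit X (\<lambda>n. poly (P n)) f sequentially"
  proof (rule uniform_limitI)
    fix e :: real assume "0 < e"
    then have "\<forall>\<^sub>F n in sequentially. inverse (real (Suc n)) < e"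
      using order_tendstoD(2)[OF LIMSEQ_inverse_real_of_nat] by blast
    then show "\<forall>\<^sub>F n in sequentially. \<forall>z\<in>X. dist (poly (P n) z) (f z) < e"
      by eventually_elim (use P less_trans in \<open>unfold dist_norm, blast\<close>)
  qed
  then show ?thesis by (rule that)
qed

lemma uniform_limit_poly_spectrum:
  assumes A: "selfadjoint_op A" and f: "continuous_on (op_spectrum A) f"
  obtains P where "uniform_limit (op_spectrum A) (\<lambda>n. poly (P n)) f sequentially"
  using uniform_limit_poly_real[OF compact_op_spectrum[OF A] op_spectrum_selfadjoint_real[OF A] f]
  by blast

text \<open>This makes the limit defining \<open>cfc\<close> independent of the approximating
  sequence.\<close>

lemma poly_op_diff_tendsto_0:
  assumes A: "selfadjoint_op A"
    and P: "uniform_limit (op_spectrum A) (\<lambda>n. poly (P n)) f F"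
    and Q: "uniform_limit (op_spectrum A) (\<lambda>n. poly (Q n)) f F"
  shows "((\<lambda>n. poly_op A (P n) - poly_op A (Q n)) \<longlongrightarrow> 0) F"
proof (rule tendstoI)
  fix e :: real assume e: "0 < e"
  have "\<forall>\<^sub>F n in F. \<forall>z\<in>op_spectrum A. dist (poly (P n) z) (f z) < e / 4"
    "\<forall>\<^sub>F n in F. \<forall>z\<in>op_spectrum A. dist (poly (Q n) z) (f z) < e / 4"
    using P Q e by (auto dest!: uniform_limitD[where e = "e / 4"])
  then show "\<forall>\<^sub>F n in F. dist (poly_op A (P n) - poly_op A (Q n)) 0 < e"
  proof eventually_elim
    case (elim n)
    have "norm (poly_op A (P n - Q n)) \<le> e / 2"
    proof (rule norm_poly_op_le[OF A])
      fix z assume "z \<in> op_spectrum A"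
      then have "dist (poly (P n) z) (f z) < e / 4" "dist (poly (Q n) z) (f z) < e / 4"
        using elim by auto
      then have "dist (poly (P n) z) (poly (Q n) z) < e / 2" by (intro dist_triangle_half_l[of _ "f z" "e / 2"]) simp_all
      then show "cmod (poly (P n - Q n) z) \<le> e / 2" by (simp add: dist_norm)
    qed (use e in simp)
    then show ?case using e by (simp add: poly_op_diff[OF selfadjoint_opD(1)[OF A]])
  qed
qed

text \<open>The function enters only through its uniform approximation on the spectrum, so functions
  that agree there select the same sequence.\<close>

definition cfc :: "('a::complex_hilbert_space \<Rightarrow>\<^sub>L 'a) \<Rightarrow> (complex \<Rightarrow> complex) \<Rightarrow> ('a \<Rightarrow>\<^sub>L 'a)"
  where "cfc A f = lim (\<lambda>n. poly_op A
    ((SOME P. uniform_limit (op_spectrum A) (\<lambda>n. poly (P n)) f sequentially) n))"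

lemma cfc_tendsto:
  assumes A: "selfadjoint_op A"
    and P: "uniform_limit (op_spectrum A) (\<lambda>n. poly (P n)) f sequentially"
  shows "(\<lambda>n. poly_op A (P n)) \<longlonglongrightarrow> cfc A f"
proof -
  define Q where "Q = (SOME P. uniform_limit (op_spectrum A) (\<lambda>n. poly (P n)) f sequentially)"
  have Q: "uniform_limit (op_spectrum A) (\<lambda>n. poly (Q n)) f sequentially"
    unfolding Q_def by (rule someI[of _ P]) (rule P)
  have "Cauchy (\<lambda>n. poly_op A (Q n))"
  proof (rule metric_CauchyI)
    fix e :: real assume e: "0 < e"
    then obtain N where N: "\<And>n z. n \<ge> N \<Longrightarrow> z \<in> op_spectrum A \<Longrightarrow> dist (poly (Q n) z) (f z) < e / 4"
      using uniform_limitD[OF Q, of "e / 4"] by (auto simp: eventually_sequentially)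
    have "dist (poly_op A (Q m)) (poly_op A (Q n)) < e" if "m \<ge> N" "n \<ge> N" for m n
    proof -
      have "norm (poly_op A (Q m - Q n)) \<le> e / 2"
      proof (rule norm_poly_op_le[OF A])
        fix z assume z: "z \<in> op_spectrum A"
        have "dist (poly (Q m) z) (poly (Q n) z) < e / 2"
          using N[OF that(1) z] N[OF that(2) z]
          by (intro dist_triangle_half_l[of _ "f z" "e / 2"]) simp_all
        then show "cmod (poly (Q m - Q n) z) \<le> e / 2" by (simp add: dist_norm)
      qed (use e in simp)
      then show ?thesis using e by (simp add: dist_norm poly_op_diff[OF selfadjoint_opD(1)[OF A]])
    qed
    then show "\<exists>M. \<forall>m\<ge>M. \<forall>n\<ge>M. dist (poly_op A (Q m)) (poly_op A (Q n)) < e" by blast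
  qed
  then have "(\<lambda>n. poly_op A (Q n)) \<longlonglongrightarrow> cfc A f"
    by (simp add: cfc_def Q_def Cauchy_convergent_iff convergent_LIMSEQ_iff)
  from tendsto_add[OF poly_op_diff_tendsto_0[OF A P Q] this] show ?thesis by simp
qed

lemma cfc_poly:
  assumes "selfadjoint_op A"
  shows "cfc A (poly p) = poly_op A p"
  using cfc_tendsto[OF assms, of "\<lambda>_. p" "poly p"]
  by (simp add: LIMSEQ_const_iff uniform_limit_const)

lemma norm_cfc_le:
  assumes A: "selfadjoint_op A" and f: "continuous_on (op_spectrum A) f"
    and M: "0 \<le> M" "\<And>z. z \<in> op_spectrum A \<Longrightarrow> cmod (f z) \<le> M"
  shows "norm (cfc A f) \<le> M"
proof (rule field_le_epsilon)
  fix e :: real assume e: "0 < e"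
  obtain P where P: "uniform_limit (op_spectrum A) (\<lambda>n. poly (P n)) f sequentially"
    using uniform_limit_poly_spectrum[OF A f] .
  have lim: "(\<lambda>n. norm (poly_op A (P n))) \<longlonglongrightarrow> norm (cfc A f)"
    by (intro tendsto_norm cfc_tendsto[OF A P])
  have "\<forall>\<^sub>F n in sequentially. norm (poly_op A (P n)) \<le> M + e"
    using uniform_limitD[OF P e]
  proof eventually_elim
    case (elim n)
    show ?case
    proof (rule norm_poly_op_le[OF A])
      fix z assume "z \<in> op_spectrum A"
      then have "dist (poly (P n) z) (f z) < e" "cmod (f z) \<le> M" using elim M by auto
      then show "cmod (poly (P n) z) \<le> M + e"
        using norm_triangle_ineq2[of "poly (P n) z" "f z"] by (simp add: dist_norm)
    qed (use M e in simp)
  qed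
  from tendsto_upperbound[OF lim this] show "norm (cfc A f) \<le> M + e" by simp
qed

text \<open>Every law holds for polynomials and passes to the limit. Products need both functions
  bounded on the spectrum, which compactness supplies; conjugation needs the spectrum real; the
  continuity constant is 1.\<close>

lemma cfc_is_functional_calculus:
  assumes A: "selfadjoint_op A"
  shows "is_functional_calculus A (cfc A)"
proof -
  note bA = selfadjoint_opD(1)[OF A]
  let ?\<sigma> = "op_spectrum A"
  have bdd: "bounded (f ` ?\<sigma>)" if "continuous_on ?\<sigma> f" for f :: "complex \<Rightarrow> complex"
    by (intro compact_imp_bounded compact_continuous_image that compact_op_spectrum[OF A])
  have 1: "cfc A f \<in> bounded_operators \<and> cfc A (\<lambda>z. cnj (f z)) = cadjoint (cfc A f) \<and>
      (\<forall>c x. cfc A (\<lambda>z. c * f z) x = c *\<^sub>C cfc A f x)" if f: "continuous_on ?\<sigma> f" for f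
  proof -
    obtain P where P: "uniform_limit ?\<sigma> (\<lambda>n. poly (P n)) f sequentially"
      using uniform_limit_poly_spectrum[OF A f] .
    note lim = cfc_tendsto[OF A P]
    have "cfc A f \<in> bounded_operators"
      by (rule bounded_operators_limit[OF _ lim]) (simp add: bA)
    moreover have "cadjoint (cfc A f) = cfc A (\<lambda>z. cnj (f z))"
    proof (rule cadjoint_eqI)
      fix x y
      have "uniform_limit ?\<sigma> (\<lambda>n. poly (map_poly cnj (P n))) (\<lambda>z. cnj (f z)) sequentially"
      proof (rule uniform_limitI)
        fix e :: real assume "0 < e"
        from uniform_limitD[OF P this]
        show "\<forall>\<^sub>F n in sequentially. \<forall>z\<in>?\<sigma>. dist (poly (map_poly cnj (P n)) z) (cnj (f z)) < e"
        proof eventually_elim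
          case (elim n)
          show ?case
          proof
            fix z assume z: "z \<in> ?\<sigma>"
            then have "cnj z = z" using op_spectrum_selfadjoint_real[OF A z] by (simp add: complex_eq_iff)
            then have "poly (map_poly cnj (P n)) z = cnj (poly (P n) z)" by (metis poly_cnj)
            then have "dist (poly (map_poly cnj (P n)) z) (cnj (f z)) = dist (poly (P n) z) (f z)"
              by (metis complex_cnj_diff complex_mod_cnj dist_norm)
            then show "dist (poly (map_poly cnj (P n)) z) (cnj (f z)) < e" using elim z by simp
          qed
        qed
      qed
      note lim' = cfc_tendsto[OF A this]
      have "(\<lambda>n. cinner (poly_op A (P n) x) y) \<longlonglongrightarrow> cinner (cfc A f x) y"
        by (intro cinner.tendsto blinfun.tendsto lim tendsto_const)
      moreover have "(\<lambda>n. cinner x (poly_op A (map_poly cnj (P n)) y)) \<longlonglongrightarrow> cinner x (cfc A (\<lambda>z. cnj (f z)) y)"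
        by (intro cinner.tendsto blinfun.tendsto lim' tendsto_const)
      ultimately show "cinner (cfc A f x) y = cinner x (cfc A (\<lambda>z. cnj (f z)) y)"
        unfolding cinner_poly_op[OF A] by (rule LIMSEQ_unique)
    qed
    moreover have "cfc A (\<lambda>z. c * f z) x = c *\<^sub>C cfc A f x" for c x
    proof -
      have "uniform_limit ?\<sigma> (\<lambda>n. poly (smult c (P n))) (\<lambda>z. c * f z) sequentially"
        using bounded_linear.uniform_limit[OF bounded_linear_mult_right[of c] P]
        by (simp add: poly_smult[abs_def])
      note lim' = cfc_tendsto[OF A this]
      have "(\<lambda>n. poly_op A (smult c (P n)) x) \<longlonglongrightarrow> cfc A (\<lambda>z. c * f z) x"
        by (intro blinfun.tendsto lim' tendsto_const)
      moreover have "(\<lambda>n. poly_op A (smult c (P n)) x) \<longlonglongrightarrow> c *\<^sub>C cfc A f x"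
        unfolding poly_op_smult[OF bA] blinfun_apply_blinfun_compose scalar_op_apply
        by (intro scaleC.tendsto blinfun.tendsto lim tendsto_const)
      ultimately show ?thesis by (rule LIMSEQ_unique)
    qed
    ultimately show ?thesis by simp
  qed
  have 2: "cfc A (\<lambda>z. f z + g z) = cfc A f + cfc A g \<and> cfc A (\<lambda>z. f z * g z) = cfc A f o\<^sub>L cfc A g"
    if f: "continuous_on ?\<sigma> f" and g: "continuous_on ?\<sigma> g" for f g
  proof -
    obtain P where P: "uniform_limit ?\<sigma> (\<lambda>n. poly (P n)) f sequentially"
      using uniform_limit_poly_spectrum[OF A f] .
    obtain Q where Q: "uniform_limit ?\<sigma> (\<lambda>n. poly (Q n)) g sequentially"
      using uniform_limit_poly_spectrum[OF A g] .
    note lim = cfc_tendsto[OF A P] cfc_tendsto[OF A Q]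
    have "uniform_limit ?\<sigma> (\<lambda>n. poly (P n + Q n)) (\<lambda>z. f z + g z) sequentially"
      using uniform_limit_add[OF P Q] by (simp add: poly_add[abs_def])
    from cfc_tendsto[OF A this]
    have "(\<lambda>n. poly_op A (P n) + poly_op A (Q n)) \<longlonglongrightarrow> cfc A (\<lambda>z. f z + g z)"
      by (simp add: poly_op_add)
    moreover have "uniform_limit ?\<sigma> (\<lambda>n. poly (P n * Q n)) (\<lambda>z. f z * g z) sequentially"
      using uniform_lim_mult[OF P Q bdd[OF f] bdd[OF g]] by (simp add: poly_mult[abs_def])
    from cfc_tendsto[OF A this]
    have "(\<lambda>n. poly_op A (P n) o\<^sub>L poly_op A (Q n)) \<longlonglongrightarrow> cfc A (\<lambda>z. f z * g z)"
      by (simp add: poly_op_mult[OF bA])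
    moreover have "(\<lambda>n. poly_op A (P n) + poly_op A (Q n)) \<longlonglongrightarrow> cfc A f + cfc A g"
      "(\<lambda>n. poly_op A (P n) o\<^sub>L poly_op A (Q n)) \<longlonglongrightarrow> (cfc A f o\<^sub>L cfc A g)"
      by (intro tendsto_add bounded_bilinear.tendsto[OF bounded_bilinear_blinfun_compose] lim)+
    ultimately show ?thesis by (meson LIMSEQ_unique)
  qed
  have 3: "norm (cfc A f) \<le> 1 * M"
    if "continuous_on ?\<sigma> f" "0 \<le> M" "\<forall>z\<in>?\<sigma>. cmod (f z) \<le> M" for f M
    using norm_cfc_le[OF A that(1,2)] that(3) by simp
  have 4: "cfc A (\<lambda>z. 1) = id_blinfun"
  proof -
    have "cfc A (\<lambda>z. 1) = cfc A (poly [:1:])" by (rule arg_cong[of _ _ "cfc A"]) auto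
    then show ?thesis by (simp add: cfc_poly[OF A] blinfun_eqI blinfun.add_left)
  qed
  have 5: "cfc A (\<lambda>z. z) = A"
  proof -
    have "cfc A (\<lambda>z. z) = cfc A (poly [:0, 1:])" by (rule arg_cong[of _ _ "cfc A"]) auto
    then show ?thesis by (simp add: cfc_poly[OF A] blinfun_eqI blinfun.add_left)
  qed
  show ?thesis unfolding is_functional_calculus_def
    using 1 2 3 4 5 by blast
qed

lemma cfc_cong:
  assumes "\<And>z. z \<in> op_spectrum A \<Longrightarrow> f z = g z"
  shows "cfc A f = cfc A g"
proof -
  have "uniform_limit (op_spectrum A) h f F = uniform_limit (op_spectrum A) h g F"
    for h :: "nat \<Rightarrow> complex \<Rightarrow> complex" and F
    by (rule uniform_limit_cong') (use assms in auto)
  then show ?thesis by (simp add: cfc_def)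
qed

lemma cfc_one:
  assumes "selfadjoint_op A"
  shows "cfc A (\<lambda>z. 1) = id_blinfun"
  using cfc_is_functional_calculus[OF assms] unfolding is_functional_calculus_def by (elim conjE)

lemma cfc_id:
  assumes "selfadjoint_op A"
  shows "cfc A (\<lambda>z. z) = A"
  using cfc_is_functional_calculus[OF assms] unfolding is_functional_calculus_def by (elim conjE)

lemma
  assumes "selfadjoint_op A" "continuous_on (op_spectrum A) f"
  shows bounded_operators_cfc: "cfc A f \<in> bounded_operators"
    and cfc_cnj: "cfc A (\<lambda>z. cnj (f z)) = cadjoint (cfc A f)"
    and cfc_cmult: "cfc A (\<lambda>z. c * f z) x = c *\<^sub>C cfc A f x"
  using cfc_is_functional_calculus[OF assms(1), unfolded is_functional_calculus_def, THEN conjunct1]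
    assms(2) by blast+

lemma
  assumes "selfadjoint_op A" "continuous_on (op_spectrum A) f" "continuous_on (op_spectrum A) g"
  shows cfc_add: "cfc A (\<lambda>z. f z + g z) = cfc A f + cfc A g"
    and cfc_mult: "cfc A (\<lambda>z. f z * g z) = cfc A f o\<^sub>L cfc A g"
  using cfc_is_functional_calculus[OF assms(1), unfolded is_functional_calculus_def,
      THEN conjunct2, THEN conjunct1] assms(2,3) by blast+

text \<open>The algebraic clauses determine \<open>\<Phi>\<close> on polynomials, and the continuity
  clause extends the agreement to their uniform limits.\<close>

lemma is_functional_calculus_unique:
  assumes A: "selfadjoint_op A" and \<Phi>: "is_functional_calculus A \<Phi>"
    and f: "continuous_on (op_spectrum A) f"
  shows "\<Phi> f = cfc A f"
proof -
  let ?\<sigma> = "op_spectrum A"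
  have scale: "\<Phi> (\<lambda>z. c * g z) x = c *\<^sub>C \<Phi> g x" if "continuous_on ?\<sigma> g" for c g x
    using \<Phi> that unfolding is_functional_calculus_def by blast
  have add: "\<Phi> (\<lambda>z. g z + h z) = \<Phi> g + \<Phi> h" and mult: "\<Phi> (\<lambda>z. g z * h z) = \<Phi> g o\<^sub>L \<Phi> h"
    if "continuous_on ?\<sigma> g" "continuous_on ?\<sigma> h" for g h
    using \<Phi> that unfolding is_functional_calculus_def by blast+
  have one: "\<Phi> (\<lambda>z. 1) = id_blinfun"
    using \<Phi> unfolding is_functional_calculus_def by (elim conjE)
  have id: "\<Phi> (\<lambda>z. z) = A"
    using \<Phi> unfolding is_functional_calculus_def by (elim conjE)
  obtain C where C: "\<And>f M. continuous_on ?\<sigma> f \<Longrightarrow> 0 \<le> M \<Longrightarrow> (\<And>z. z \<in> ?\<sigma> \<Longrightarrow> cmod (f z) \<le> M)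
      \<Longrightarrow> norm (\<Phi> f) \<le> C * M"
    using \<Phi>[unfolded is_functional_calculus_def, THEN conjunct2, THEN conjunct2, THEN conjunct2,
        THEN conjunct2] by blast
  have const: "\<Phi> (\<lambda>z. c) = scalar_op c" for c
    by (rule blinfun_eqI) (use scale[of "\<lambda>z. 1" c] one in simp)
  have poly: "\<Phi> (poly p) = poly_op A p" for p
  proof (induction p)
    case 0
    have "poly 0 = (\<lambda>z::complex. 0)" by auto
    then show ?case by (simp add: const)
  next
    case (pCons a p)
    have "poly (pCons a p) = (\<lambda>z. a + z * poly p z)" by auto
    then have "\<Phi> (poly (pCons a p)) = \<Phi> (\<lambda>z. a) + \<Phi> (\<lambda>z. z * poly p z)"
      by (simp add: add continuous_intros)
    also have "\<Phi> (\<lambda>z. z * poly p z) = A o\<^sub>L \<Phi> (\<lambda>z. poly p z)"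
      by (simp add: mult continuous_intros id)
    finally show ?case by (simp add: const pCons.IH)
  qed
  obtain P where P: "uniform_limit ?\<sigma> (\<lambda>n. poly (P n)) f sequentially"
    using uniform_limit_poly_spectrum[OF A f] .
  have "(\<lambda>n. poly_op A (P n)) \<longlonglongrightarrow> \<Phi> f"
  proof (rule tendstoI)
    fix e :: real assume e: "0 < e"
    \<comment> \<open>Nothing is known about the sign of \<open>C\<close>;
      \<open>\<bar>C\<bar> + 1\<close> is a positive bound strictly above it.\<close>
    define d where "d = e / (\<bar>C\<bar> + 1)"
    have d: "0 < d" using e by (simp add: d_def)
    show "\<forall>\<^sub>F n in sequentially. dist (poly_op A (P n)) (\<Phi> f) < e"
      using uniform_limitD[OF P d]
    proof eventually_elim
      case (elim n)
      have "\<Phi> (\<lambda>z. poly (P n) z + (-1) * f z) = \<Phi> (poly (P n)) + \<Phi> (\<lambda>z. (-1) * f z)"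
        by (intro add continuous_intros f)
      also have "\<Phi> (\<lambda>z. (-1) * f z) = - \<Phi> f"
        by (rule blinfun_eqI) (simp only: scale[OF f] scaleC.minus_left blinfun.minus_left scaleC_one)
      finally have eq: "poly_op A (P n) - \<Phi> f = \<Phi> (\<lambda>z. poly (P n) z + (-1) * f z)"
        by (simp add: poly)
      have "norm (\<Phi> (\<lambda>z. poly (P n) z + (-1) * f z)) \<le> C * d"
        by (rule C) (use elim d in \<open>auto intro!: continuous_intros f less_imp_le simp: dist_norm\<close>)
      also have "\<dots> \<le> \<bar>C\<bar> * d" using d by (intro mult_right_mono) auto
      also have "\<dots> < (\<bar>C\<bar> + 1) * d" using d by simp
      also have "\<dots> = e" by (simp add: d_def)
      finally show ?case by (simp add: dist_norm eq)
    qed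
  qed
  then show ?thesis using cfc_tendsto[OF A P] LIMSEQ_unique by blast
qed

lemma functional_calculus_eq_cfc:
  assumes "selfadjoint_op A" "continuous_on (op_spectrum A) f"
  shows "functional_calculus A f = cfc A f"
  unfolding functional_calculus_def
proof (rule the_equality)
  show "\<exists>\<Phi>. is_functional_calculus A \<Phi> \<and> \<Phi> f = cfc A f"
    using cfc_is_functional_calculus[OF assms(1)] by blast
  show "B = cfc A f" if "\<exists>\<Phi>. is_functional_calculus A \<Phi> \<and> \<Phi> f = B" for B
    using that is_functional_calculus_unique[OF assms(1) _ assms(2)] by blast
qed

section \<open>Real powers\<close>

text \<open>Young's inequality for \<open>y powr r\<close> and \<open>m powr r\<close> with weights
  \<open>1 / r\<close> and \<open>1 - 1 / r\<close>, rearranged. At \<open>y = 0\<close> the tangent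
  has the nonpositive value \<open>(1 - r) * m powr r\<close>.\<close>

lemma powr_above_tangent:
  fixes y m r :: real
  assumes "0 \<le> y" "0 < m" "1 \<le> r"
  shows "m powr r + r * m powr (r - 1) * (y - m) \<le> y powr r"
proof (cases "y = 0")
  case True
  have "m powr (r - 1) * m = m powr r" using assms powr_add[of m "r - 1" 1] by simp
  then have "m powr r + r * m powr (r - 1) * (y - m) = (1 - r) * m powr r"
    using True by (simp add: algebra_simps)
  also have "\<dots> \<le> 0" using assms by (simp add: mult_nonpos_nonneg)
  finally show ?thesis using True by simp
next
  case False
  have "(y powr r) powr (1 / r) * (m powr r) powr (1 - 1 / r) \<le>
      (1 / r) * y powr r + (1 - 1 / r) * m powr r"
    by (rule Youngs_inequality_0) (use assms False in auto)
  moreover have "(y powr r) powr (1 / r) = y" "(m powr r) powr (1 - 1 / r) = m powr (r - 1)"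
    using assms by (simp_all add: powr_powr right_diff_distrib)
  ultimately have *: "y * m powr (r - 1) \<le> (1 / r) * y powr r + (1 - 1 / r) * m powr r"
    by simp
  have "r * (y * m powr (r - 1)) \<le> r * ((1 / r) * y powr r + (1 - 1 / r) * m powr r)"
    using assms by (intro mult_left_mono *) auto
  also have "\<dots> = y powr r + (r - 1) * m powr r"
    using assms by (simp add: field_simps)
  finally have "r * (y * m powr (r - 1)) \<le> y powr r + (r - 1) * m powr r" .
  moreover have "m powr (r - 1) * m = m powr r" using assms powr_add[of m "r - 1" 1] by simp
  then have "m powr r + r * m powr (r - 1) * (y - m) = r * (y * m powr (r - 1)) - (r - 1) * m powr r"
    by (simp add: algebra_simps)
  ultimately show ?thesis by linarith
qed

text \<open>A two-sided geometric series with ratio \<open>l powr (- p)\<close> towards minus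
  infinity and \<open>l powr (p - 1)\<close> towards plus infinity; \<open>0 < p < 1\<close> makes
  both smaller than 1.\<close>

lemma summable_on_min_geometric:
  fixes l p R :: real
  assumes "1 < l" "0 < p" "p < 1"
  shows "(\<lambda>k::int. if k < 0 then l powr (real_of_int k * p)
    else R * l powr (real_of_int k * (p - 1))) summable_on UNIV"
    (is "?b summable_on UNIV")
proof -
  have pw: "l powr (real n * a) = (l powr a) ^ n" for n a
    using assms by (simp add: powr_powr[symmetric] mult.commute[of "real n"] powr_realpow)
  have geo: "(\<lambda>n. c * q ^ n) summable_on UNIV" if "0 \<le> q" "q < 1" for c q :: real
    using that by (intro summable_on_cmult_right) (simp add: summable_on_UNIV_nonneg_real_iff summable_geometric)
  have "(?b \<circ> int) = (\<lambda>n. R * (l powr (p - 1)) ^ n)" by (auto simp: pw)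
  moreover have "l powr (p - 1) < 1" using assms by (simp add: powr_less_one)
  ultimately have 1: "?b summable_on (range int)"
    by (subst summable_on_reindex) (auto simp: geo inj_on_def)
  \<comment> \<open>The shift by one enumerates exactly the negative integers, so that index 0 is
    not counted twice.\<close>
  have "(?b \<circ> (\<lambda>n. - int n - 1)) = (\<lambda>n. l powr (- p) * (l powr (- p)) ^ n)"
  proof
    fix n
    have "real_of_int (- int n - 1) * p = - p + real n * (- p)" by (simp add: algebra_simps)
    then have "l powr (real_of_int (- int n - 1) * p) = l powr (- p) * (l powr (- p)) ^ n"
      by (simp only: powr_add pw)
    then show "(?b \<circ> (\<lambda>n. - int n - 1)) n = l powr (- p) * (l powr (- p)) ^ n" by simp
  qed
  moreover have "l powr (- p) < 1" using assms by (simp add: powr_less_one)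
  ultimately have 2: "?b summable_on (range (\<lambda>n. - int n - 1))"
    by (subst summable_on_reindex) (auto simp: geo inj_on_def)
  have "k \<in> range int \<union> range (\<lambda>n. - int n - 1)" for k
  proof (cases "0 \<le> k")
    case True
    then show ?thesis by (auto intro: image_eqI[of _ _ "nat k"])
  next
    case False
    then show ?thesis by (auto intro: image_eqI[of _ _ "nat (- k - 1)"])
  qed
  then have "range int \<union> range (\<lambda>n. - int n - 1) = UNIV" by blast
  moreover have "range int \<inter> range (\<lambda>n. - int n - 1) = {}" by auto
  ultimately show ?thesis using summable_on_Un_disjoint[OF 1 2] by simp
qed

text \<open>With \<open>S x = (\<Sum>k\<in>\<int>. l powr (k p) x / (x + l powr k))\<close>, a discrete analogue of
  \<open>\<integral> s powr (p - 1) x / (x + s) ds\<close>, the identity \<open>S (l powr j * x) = l powr (j p) * S x\<close>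
  and monotonicity of \<open>S\<close> pin \<open>S x / S 1\<close> to \<open>x powr p\<close> up to a factor \<open>l powr p\<close>, which
  tends to \<open>1\<close> as \<open>l\<close> does.\<close>

lemma powr_approx_resolvents:
  fixes p R e :: real
  assumes p: "0 < p" "p < 1" and R: "0 < R" and e: "0 < e"
  obtains F :: "int set" and c s :: "int \<Rightarrow> real"
  where "finite F" "\<And>k. 0 \<le> c k" "\<And>k. 0 < s k"
    "\<And>x. 0 \<le> x \<Longrightarrow> x \<le> R \<Longrightarrow> \<bar>x powr p - (\<Sum>k\<in>F. c k * (x / (x + s k)))\<bar> \<le> e"
proof -
  \<comment> \<open>Consecutive values \<open>l powr (j * p)\<close> will differ by the factor
    \<open>1 + d\<close>, so the sandwich costs at most \<open>R powr p * d = e / 2\<close>.\<close>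
  define d where "d = e / (2 * R powr p)"
  have d: "0 < d" using R e by (simp add: d_def)
  define l where "l = (1 + d) powr (1 / p)"
  have l: "1 < l" using d p by (simp add: l_def gr_one_powr)
  have lp: "l powr p = 1 + d" using d p by (simp add: l_def powr_powr)
  define u where "u k x = l powr (k * p) * (x / (x + l powr k))" for k :: int and x
  \<comment> \<open>A summable majorant of \<open>u k x\<close> independent of \<open>x\<close> on
    \<open>{0..R}\<close>, so that one finite index set serves all \<open>x\<close>.\<close>
  define b where "b k = (if k < 0 then l powr (k * p) else R * l powr (k * (p - 1)))" for k :: int
  have b: "b summable_on UNIV" unfolding b_def by (rule summable_on_min_geometric[OF l p])
  have u_nonneg: "0 \<le> u k x" if "0 \<le> x" for k x using that by (simp add: u_def)
  \<comment> \<open>This holds for every upper limit, not only the fixed \<open>R\<close>, because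
    \<open>S\<close> is also evaluated at powers of \<open>l\<close> that may exceed it.\<close>
  have u_le: "u k x \<le> (if k < 0 then l powr (k * p) else R * l powr (k * (p - 1)))"
    if "0 \<le> x" "x \<le> R" for k x R
  proof (cases "k < 0")
    case True
    have "x / (x + l powr k) \<le> 1" using that l by (simp add: add_nonneg_pos)
    then have "u k x \<le> l powr (k * p) * 1" unfolding u_def by (intro mult_left_mono) auto
    then show ?thesis using True by simp
  next
    case False
    have "x / (x + l powr k) \<le> R / l powr k" using that l by (intro frac_le) auto
    then have "u k x \<le> l powr (k * p) * (R / l powr k)" unfolding u_def by (intro mult_left_mono) auto
    also have "\<dots> = R * l powr (k * (p - 1))" by (simp add: right_diff_distrib powr_diff)
    finally show ?thesis using False by simp
  qed
  then have u_le_b: "u k x \<le> b k" if "0 \<le> x" "x \<le> R" for k x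
    unfolding b_def using that by blast
  have u_scale: "u k (l powr j * x) = l powr (j * p) * u (k - j) x" for k j :: int and x
  proof -
    have "l powr k = l powr j * l powr (k - j)" using l by (simp flip: powr_add)
    then have "l powr j * x / (l powr j * x + l powr k) = x / (x + l powr (k - j))"
      using l by (simp add: distrib_left[symmetric])
    moreover have "l powr (k * p) = l powr (j * p) * l powr ((k - j) * p)"
      using l by (simp add: left_diff_distrib flip: powr_add)
    ultimately show ?thesis by (simp add: u_def)
  qed
  have u_mono: "u k x \<le> u k y" if "0 \<le> x" "x \<le> y" for k x y
  proof -
    have "x / (x + l powr k) \<le> y / (y + l powr k)"
      using that l by (simp add: frac_le_eq add_nonneg_pos divide_simps)
        (simp add: algebra_simps mult_right_mono)
    then show ?thesis unfolding u_def by (intro mult_left_mono) auto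
  qed
  have u_summable: "(\<lambda>k. u k x) summable_on UNIV" if "0 \<le> x" for x
    by (rule summable_on_comparison_test[OF summable_on_min_geometric[OF l p, of x]])
      (use that u_le u_nonneg in auto)
  define S where "S x = (\<Sum>\<^sub>\<infinity>k. u k x)" for x
  have S_scale: "S (l powr j) = l powr (j * p) * S 1" for j :: int
  proof -
    have "bij_betw (\<lambda>k. k - j) UNIV UNIV" by (rule bij_betw_byWitness[of _ "\<lambda>k. k + j"]) auto
    from infsum_reindex_bij_betw[OF this, of "\<lambda>k. u k 1"] show ?thesis
      using u_scale[of _ j 1] by (simp add: S_def infsum_cmult_right')
  qed
  have S_mono: "S x \<le> S y" if "0 \<le> x" "x \<le> y" for x y
    unfolding S_def by (intro infsum_mono u_summable u_mono) (use that in auto)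
  have "sum (\<lambda>k. u k 1) {0} \<le> S 1"
    unfolding S_def by (rule finite_sum_le_infsum) (auto intro: u_summable u_nonneg)
  then have S1: "0 < S 1" using l by (simp add: u_def)
  have S_approx: "\<bar>x powr p - S x / S 1\<bar> \<le> e / 2" if x: "0 \<le> x" "x \<le> R" for x
  proof (cases "x = 0")
    case True
    then show ?thesis using e by (simp add: S_def u_def)
  next
    case False
    \<comment> \<open>Places \<open>x\<close> between the consecutive powers \<open>l powr j\<close>
      and \<open>l powr (j + 1)\<close>, where \<open>S\<close> is known exactly.\<close>
    define j where "j = \<lfloor>log l x\<rfloor>"
    have "l powr j \<le> l powr (log l x)" "l powr (log l x) \<le> l powr (of_int (j + 1))"
      using l unfolding j_def by (auto intro!: powr_mono)
    then have j: "l powr j \<le> x" "x \<le> l powr (of_int (j + 1))" using l x False by auto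
    have "S (l powr j) \<le> S x" "S x \<le> S (l powr (of_int (j + 1)))"
      using j l x by (auto intro!: S_mono)
    then have "l powr (j * p) \<le> S x / S 1" "S x / S 1 \<le> l powr ((j + 1) * p)"
      using S1 by (simp_all add: S_scale pos_le_divide_eq pos_divide_le_eq del: of_int_add)
    moreover have "l powr (j * p) \<le> x powr p" "x powr p \<le> l powr ((j + 1) * p)"
      using powr_mono2[of p "l powr j" x] powr_mono2[of p x "l powr (of_int (j + 1))"] j p x l
      by (simp_all add: powr_powr del: of_int_add)
    moreover have "l powr ((j + 1) * p) = l powr (j * p) * (1 + d)"
      by (simp add: distrib_right powr_add lp)
    moreover have "l powr (j * p) * d \<le> e / 2"
    proof -
      have "l powr (j * p) * d \<le> R powr p * d"
        using \<open>l powr (j * p) \<le> x powr p\<close> powr_mono2[of p x R] x p d by (intro mult_right_mono) auto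
      then show ?thesis using R by (simp add: d_def)
    qed
    ultimately have "x powr p - S x / S 1 \<le> e / 2" "- (x powr p - S x / S 1) \<le> e / 2"
      unfolding distrib_left by argo+
    then show ?thesis by (rule abs_leI)
  qed
  \<comment> \<open>The tolerance carries the factor \<open>S 1\<close> because the sum is divided
    by \<open>S 1\<close> in the end.\<close>
  obtain F where F: "finite F" "dist (sum b F) (infsum b UNIV) \<le> S 1 * e / 2"
    using infsum_finite_approximation[OF b, of "S 1 * e / 2"] S1 e by auto
  have F_approx: "\<bar>S x - (\<Sum>k\<in>F. u k x)\<bar> \<le> S 1 * e / 2" if x: "0 \<le> x" "x \<le> R" for x
  proof -
    have "(\<Sum>k\<in>F. u k x) \<le> S x"
      unfolding S_def by (rule finite_sum_le_infsum) (auto intro: u_summable u_nonneg F x)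
    \<comment> \<open>Partial sums of the nonnegative terms \<open>b k - u k x\<close> stay below
      their total: the tail of \<open>u\<close> is dominated by the tail of
      \<open>b\<close>.\<close>
    moreover have "(\<Sum>k\<in>F. b k + - u k x) \<le> (\<Sum>\<^sub>\<infinity>k. b k + - u k x)"
    proof (rule finite_sum_le_infsum)
      show "(\<lambda>k. b k + - u k x) summable_on UNIV"
        by (intro summable_on_add b) (simp add: summable_on_uminus u_summable x)
    qed (use F u_le_b x in auto)
    then have "sum b F - (\<Sum>k\<in>F. u k x) \<le> infsum b UNIV - S x"
      using infsum_add[of b UNIV "\<lambda>k. - u k x"]
      by (simp add: S_def sum_subtractf infsum_uminus summable_on_uminus b u_summable x)
    ultimately show ?thesis using F(2) by (simp add: dist_real_def)
  qed
  show ?thesis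
  proof (rule that[of F "\<lambda>k. l powr (k * p) / S 1" "\<lambda>k. l powr k"])
    fix x assume x: "0 \<le> x" "x \<le> R"
    have "(\<Sum>k\<in>F. l powr (k * p) / S 1 * (x / (x + l powr k))) = (\<Sum>k\<in>F. u k x) / S 1"
      by (simp add: u_def sum_divide_distrib mult.commute[of "S 1"])
    moreover have "\<bar>S x / S 1 - (\<Sum>k\<in>F. u k x) / S 1\<bar> \<le> e / 2"
      using F_approx[OF x] S1 by (simp add: diff_divide_distrib[symmetric] abs_div pos_divide_le_eq mult.commute)
    ultimately show "\<bar>x powr p - (\<Sum>k\<in>F. l powr (k * p) / S 1 * (x / (x + l powr k)))\<bar> \<le> e"
      using S_approx[OF x] by linarith
  qed (use F S1 l in auto)
qed

section \<open>Functional calculus of a positive operator\<close>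

abbreviation qform :: "('a::complex_inner \<Rightarrow>\<^sub>L 'a) \<Rightarrow> 'a \<Rightarrow> real"
  where "qform A x \<equiv> Re (cinner (blinfun_apply A x) x)"

definition positive_op :: "('a::complex_hilbert_space \<Rightarrow>\<^sub>L 'a) \<Rightarrow> bool"
  where "positive_op A \<longleftrightarrow> selfadjoint_op A \<and> (\<forall>x. 0 \<le> qform A x)"

lemma positive_opD:
  assumes "positive_op A"
  shows "selfadjoint_op A" "A \<in> bounded_operators" "0 \<le> qform A x"
  using assms by (auto simp: positive_op_def selfadjoint_op_def)

lemma qform_le_norm: "qform A x \<le> norm A * (norm x)\<^sup>2"
proof -
  have "qform A x \<le> norm (A x) * norm x" by (rule Re_cinner_le)
  also have "\<dots> \<le> norm A * norm x * norm x" by (intro mult_right_mono norm_blinfun) auto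
  finally show ?thesis by (simp add: power2_eq_square mult.assoc)
qed

text \<open>Positivity at the test vector \<open>x - (1 / d) *\<^sub>R A x\<close>, with the form
  bounded by \<open>d\<close> at both \<open>x\<close> and \<open>A x\<close>, leaves
  \<open>norm (A x) \<le> d * norm x\<close>.\<close>

lemma norm_positive_op_le:
  assumes A: "positive_op A" and c: "0 \<le> c" "\<And>x. qform A x \<le> c * (norm x)\<^sup>2"
  shows "norm A \<le> c"
proof (rule field_le_epsilon)
  fix e :: real assume "0 < e"
  \<comment> \<open>The slack \<open>e\<close> permits division by \<open>d\<close> even when
    \<open>c = 0\<close>.\<close>
  define d where "d = c + e"
  have d: "0 < d" and qd: "qform A x \<le> d * (norm x)\<^sup>2" for x
    using c(1) c(2)[of x] \<open>0 < e\<close> by (auto simp: d_def distrib_right add_increasing2)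
  have "norm (A x) \<le> d * norm x" for x
  proof (rule power2_le_imp_le)
    have "qform A (x - (1 / d) *\<^sub>R A x) =
        qform A x - 2 / d * (norm (A x))\<^sup>2 + (1 / d)\<^sup>2 * qform A (A x)"
      using selfadjoint_opD(2)[OF positive_opD(1)[OF A], of "A x" x]
      by (simp add: blinfun.diff_right blinfun.scaleR_right cinner.diff_left cinner.diff_right
          cinner.scaleR_left cinner.scaleR_right Re_cinner_self power2_eq_square algebra_simps)
    also have "\<dots> \<le> d * (norm x)\<^sup>2 - 2 / d * (norm (A x))\<^sup>2 + (1 / d)\<^sup>2 * (d * (norm (A x))\<^sup>2)"
      by (intro add_mono diff_right_mono mult_left_mono qd) auto
    also have "\<dots> = d * (norm x)\<^sup>2 - (norm (A x))\<^sup>2 / d"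
      using d by (simp add: field_simps power2_eq_square)
    finally have "(norm (A x))\<^sup>2 / d \<le> d * (norm x)\<^sup>2"
      using positive_opD(3)[OF A, of "x - (1 / d) *\<^sub>R A x"] by linarith
    then show "(norm (A x))\<^sup>2 \<le> (d * norm x)\<^sup>2"
      using d by (simp add: pos_divide_le_eq power_mult_distrib power2_eq_square mult_ac)
  qed (use d in simp)
  then show "norm A \<le> c + e" unfolding d_def[symmetric] using d by (intro norm_blinfun_bound) auto
qed

text \<open>For \<open>Re z < 0\<close> all three terms in the expansion of the squared norm of
  \<open>A x - Re z *\<^sub>R x\<close> are nonnegative, so \<open>- Re z\<close> is a lower
  bound.\<close>

lemma op_spectrum_positive:
  assumes A: "positive_op A" and z: "z \<in> op_spectrum A"
  shows "0 \<le> Re z" "Re z \<le> norm A" "complex_of_real (Re z) = z"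
proof -
  note sa = positive_opD(1)[OF A]
  show eq: "complex_of_real (Re z) = z"
    using op_spectrum_selfadjoint_real[OF sa z] by (simp add: complex_eq_iff)
  show "Re z \<le> norm A"
    using op_spectrum_selfadjoint_norm[OF sa z] complex_Re_le_cmod[of z] by linarith
  show "0 \<le> Re z"
  proof (rule ccontr)
    assume neg: "\<not> 0 \<le> Re z"
    have "- Re z * norm x \<le> norm (A x - z *\<^sub>C x)" for x
    proof (rule power2_le_imp_le)
      have "(norm (A x - Re z *\<^sub>R x))\<^sup>2 = (norm (A x))\<^sup>2 - 2 * Re z * qform A x + (Re z)\<^sup>2 * (norm x)\<^sup>2"
        using norm_add_sqr[of "A x" "- (Re z *\<^sub>R x)"]
        by (simp add: cinner.minus_right cinner.scaleR_right power_mult_distrib)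
      moreover have "Re z * qform A x \<le> 0"
        using neg positive_opD(3)[OF A, of x] by (simp add: mult_nonpos_nonneg)
      ultimately have "(Re z)\<^sup>2 * (norm x)\<^sup>2 \<le> (norm (A x - Re z *\<^sub>R x))\<^sup>2"
        using zero_le_power2[of "norm (A x)"] by linarith
      moreover have "Re z *\<^sub>R x = z *\<^sub>C x" by (simp add: scaleR_eq_scaleC eq)
      ultimately show "(- Re z * norm x)\<^sup>2 \<le> (norm (A x - z *\<^sub>C x))\<^sup>2"
        by (simp add: power_mult_distrib)
    qed simp
    then show False
      using op_spectrum_selfadjoint_bounded_below[OF sa, of "- Re z" z] neg z by simp
  qed
qed

definition rfc :: "('a::complex_hilbert_space \<Rightarrow>\<^sub>L 'a) \<Rightarrow> (real \<Rightarrow> real) \<Rightarrow> ('a \<Rightarrow>\<^sub>L 'a)"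
  where "rfc A f = cfc A (\<lambda>z. complex_of_real (f (Re z)))"

lemma continuous_on_spectrum:
  assumes "positive_op A" "continuous_on {0..} f"
  shows "continuous_on (op_spectrum A) (\<lambda>z. complex_of_real (f (Re z)))"
  by (intro continuous_intros continuous_on_compose2[OF assms(2)])
    (use op_spectrum_positive[OF assms(1)] in auto)

lemma op_powr_eq_rfc:
  assumes "positive_op A" "0 < r"
  shows "op_powr A r = rfc A (\<lambda>x. x powr r)"
  unfolding op_powr_def rfc_def
  by (intro functional_calculus_eq_cfc positive_opD continuous_on_spectrum[of _ "\<lambda>x. x powr r"] assms
      continuous_on_powr' continuous_intros) (use assms in auto)

lemma rfc_add:
  assumes "positive_op A" "continuous_on {0..} f" "continuous_on {0..} g"
  shows "rfc A (\<lambda>x. f x + g x) = rfc A f + rfc A g"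
  using cfc_add[OF positive_opD(1)[OF assms(1)] continuous_on_spectrum[OF assms(1,2)]
      continuous_on_spectrum[OF assms(1,3)]]
  by (simp add: rfc_def)

lemma rfc_mult:
  assumes "positive_op A" "continuous_on {0..} f" "continuous_on {0..} g"
  shows "rfc A (\<lambda>x. f x * g x) = rfc A f o\<^sub>L rfc A g"
  using cfc_mult[OF positive_opD(1)[OF assms(1)] continuous_on_spectrum[OF assms(1,2)]
      continuous_on_spectrum[OF assms(1,3)]]
  by (simp add: rfc_def)

lemma rfc_cmult:
  assumes "positive_op A" "continuous_on {0..} f"
  shows "rfc A (\<lambda>x. c * f x) = c *\<^sub>R rfc A f"
proof (rule blinfun_eqI)
  show "rfc A (\<lambda>x. c * f x) x = (c *\<^sub>R rfc A f) x" for x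
    using cfc_cmult[OF positive_opD(1)[OF assms(1)] continuous_on_spectrum[OF assms]]
    by (simp only: rfc_def of_real_mult blinfun.scaleR_left scaleR_eq_scaleC)
qed

lemma norm_rfc_le:
  assumes "positive_op A" "continuous_on {0..} f"
    "0 \<le> M" "\<And>x. 0 \<le> x \<Longrightarrow> x \<le> norm A \<Longrightarrow> \<bar>f x\<bar> \<le> M"
  shows "norm (rfc A f) \<le> M"
  unfolding rfc_def
  by (rule norm_cfc_le[OF positive_opD(1)[OF assms(1)] continuous_on_spectrum[OF assms(1,2)] assms(3)])
    (use op_spectrum_positive[OF assms(1)] assms(4) in auto)

lemma rfc_diff:
  assumes "positive_op A" "continuous_on {0..} f" "continuous_on {0..} g"
  shows "rfc A (\<lambda>x. f x - g x) = rfc A f - rfc A g"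
proof -
  have "rfc A (\<lambda>x. f x + (- 1) * g x) = rfc A f + (- 1) *\<^sub>R rfc A g"
    using assms by (subst rfc_add) (auto intro!: continuous_intros simp only: rfc_cmult)
  then show ?thesis by simp
qed

lemma rfc_cong:
  assumes "positive_op A" "\<And>x. 0 \<le> x \<Longrightarrow> x \<le> norm A \<Longrightarrow> f x = g x"
  shows "rfc A f = rfc A g"
  unfolding rfc_def
  by (rule cfc_cong) (use assms(2) op_spectrum_positive[OF assms(1)] in auto)

lemma rfc_id:
  assumes "positive_op A"
  shows "rfc A (\<lambda>x. x) = A"
proof -
  have "rfc A (\<lambda>x. x) = cfc A (\<lambda>z. z)"
    unfolding rfc_def by (rule cfc_cong) (rule op_spectrum_positive[OF assms])
  then show ?thesis by (simp add: cfc_id positive_opD[OF assms])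
qed

lemma rfc_const:
  assumes "positive_op A"
  shows "rfc A (\<lambda>x. c) = c *\<^sub>R id_blinfun"
proof -
  have "rfc A (\<lambda>x. 1) = id_blinfun" by (simp add: rfc_def cfc_one positive_opD[OF assms])
  then show ?thesis using rfc_cmult[OF assms continuous_on_const, of c 1] by simp
qed

lemma selfadjoint_rfc:
  assumes "positive_op A" "continuous_on {0..} f"
  shows "selfadjoint_op (rfc A f)"
proof -
  note sa = positive_opD(1)[OF assms(1)] and cont = continuous_on_spectrum[OF assms]
  have bd: "rfc A f \<in> bounded_operators"
    unfolding rfc_def by (rule bounded_operators_cfc[OF sa cont])
  moreover have "cadjoint (rfc A f) = rfc A f"
    using cfc_cnj[OF sa cont] by (simp add: rfc_def)
  ultimately show ?thesis using cinner_cadjoint[OF bd] by (simp add: selfadjoint_op_def)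
qed

text \<open>With \<open>g\<close> the square root of \<open>f\<close>, the form of
  \<open>f(A)\<close> at \<open>x\<close> is the squared norm of \<open>g(A) x\<close>.\<close>

lemma positive_rfc:
  assumes A: "positive_op A" and f: "continuous_on {0..} f"
    and nonneg: "\<And>x. 0 \<le> x \<Longrightarrow> x \<le> norm A \<Longrightarrow> 0 \<le> f x"
  shows "positive_op (rfc A f)"
proof -
  \<comment> \<open>The truncation is harmless on the spectrum; it gives a continuous root on the
    whole half-line, where \<open>f\<close> may turn negative beyond \<open>norm A\<close>.\<close>
  define g where "g x = sqrt (max 0 (f x))" for x
  have g: "continuous_on {0..} g" unfolding g_def by (intro continuous_intros f)
  have "rfc A f = rfc A (\<lambda>x. g x * g x)"
    by (rule rfc_cong[OF A]) (use nonneg in \<open>simp add: g_def\<close>)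
  then have "rfc A f = rfc A g o\<^sub>L rfc A g" by (simp add: rfc_mult A g)
  then have "qform (rfc A f) x = (norm (rfc A g x))\<^sup>2" for x
    using selfadjoint_opD(2)[OF selfadjoint_rfc[OF A g], of "rfc A g x" x]
    by (simp add: Re_cinner_self)
  then show ?thesis using selfadjoint_rfc[OF A f] by (simp add: positive_op_def)
qed

lemma qform_rfc_mono:
  assumes A: "positive_op A" and f: "continuous_on {0..} f" and g: "continuous_on {0..} g"
    and le: "\<And>x. 0 \<le> x \<Longrightarrow> x \<le> norm A \<Longrightarrow> f x \<le> g x"
  shows "qform (rfc A f) x \<le> qform (rfc A g) x"
proof -
  have "positive_op (rfc A (\<lambda>x. g x - f x))"
    by (rule positive_rfc) (use A f g le in \<open>auto intro!: continuous_intros\<close>)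
  from positive_opD(3)[OF this, of x] show ?thesis
    by (simp add: rfc_diff A f g blinfun.diff_left cinner.diff_left)
qed

lemma continuous_on_powr_atLeast: "0 < r \<Longrightarrow> continuous_on {0..} (\<lambda>x::real. x powr r)"
  by (intro continuous_on_powr' continuous_intros) auto

text \<open>The tangent to \<open>y powr r\<close> at \<open>m = qform A x\<close> lies below the
  power, and for a unit vector the form of this affine function of \<open>A\<close> is exactly
  \<open>m powr r\<close>. The tangent requires \<open>m > 0\<close>; for \<open>m = 0\<close>
  positivity suffices.\<close>

lemma op_powr_Jensen:
  assumes A: "positive_op A" and r: "1 \<le> r" and x: "norm x = 1"
  shows "qform A x powr r \<le> qform (op_powr A r) x"
proof -
  have r0: "0 < r" using r by simp
  define m where "m = qform A x"
  note cont = continuous_on_powr_atLeast[OF r0]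
  show ?thesis
  proof (cases "m = 0")
    case True
    have "positive_op (rfc A (\<lambda>x. x powr r))" by (rule positive_rfc[OF A cont]) simp
    from positive_opD(3)[OF this, of x] show ?thesis
      using True by (simp add: m_def[symmetric] op_powr_eq_rfc[OF A r0])
  next
    case False
    then have m: "0 < m" using positive_opD(3)[OF A, of x] by (simp add: m_def)
    define k where "k = r * m powr (r - 1)"
    have "rfc A (\<lambda>y. (m powr r - k * m) + k * y) = (m powr r - k * m) *\<^sub>R id_blinfun + k *\<^sub>R A"
      by (subst rfc_add) (auto intro!: continuous_intros A simp: rfc_const rfc_cmult rfc_id A)
    then have "qform (rfc A (\<lambda>y. (m powr r - k * m) + k * y)) x = (m powr r - k * m) + k * m"
      by (simp add: blinfun.add_left blinfun.scaleR_left cinner_add_left cinner.scaleR_left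
          m_def[symmetric] Re_cinner_self x)
    moreover have "qform (rfc A (\<lambda>y. (m powr r - k * m) + k * y)) x \<le> qform (rfc A (\<lambda>y. y powr r)) x"
    proof (rule qform_rfc_mono[OF A _ cont])
      show "(m powr r - k * m) + k * y \<le> y powr r" if "0 \<le> y" for y
        using powr_above_tangent[OF that m r] by (simp add: k_def algebra_simps)
    qed (intro continuous_intros)
    ultimately show ?thesis by (simp add: m_def op_powr_eq_rfc[OF A r0])
  qed
qed

section \<open>Operator convexity of the power function\<close>

lemma positive_op_convex:
  assumes "positive_op A" "positive_op B" "0 \<le> t" "t \<le> 1"
  shows "positive_op (t *\<^sub>R A + (1 - t) *\<^sub>R B)"
  using assms unfolding positive_op_def selfadjoint_op_def
  by (auto simp: blinfun.add_left blinfun.scaleR_left cinner_add_left cinner_add_right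
      cinner.scaleR_left cinner.scaleR_right)

lemma norm_convex_le:
  assumes "0 \<le> t" "t \<le> 1"
  shows "norm (t *\<^sub>R A + (1 - t) *\<^sub>R B) \<le> max (norm A) (norm (B::'a::real_normed_vector))"
proof -
  have "norm (t *\<^sub>R A + (1 - t) *\<^sub>R B) \<le> t * norm A + (1 - t) * norm B"
    using norm_triangle_ineq[of "t *\<^sub>R A" "(1 - t) *\<^sub>R B"] assms by simp
  also have "\<dots> \<le> max (norm A) (norm B)"
    by (rule convex_bound_le) (use assms in auto)
  finally show ?thesis .
qed

section \<open>The Jensen defect of a convex combination\<close>

locale convex_combination =
  fixes A B C :: "'a::complex_hilbert_space \<Rightarrow>\<^sub>L 'a" and t :: real
  assumes A: "positive_op A" and B: "positive_op B" and t: "0 \<le> t" "t \<le> 1"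
    and C_def: "C = t *\<^sub>R A + (1 - t) *\<^sub>R B"
begin

lemma C: "positive_op C"
  unfolding C_def by (rule positive_op_convex[OF A B t])

lemma qform_C: "qform C x = t * qform A x + (1 - t) * qform B x"
  by (simp add: C_def blinfun.add_left blinfun.scaleR_left cinner_add_left cinner.scaleR_left)

text \<open>Operator convexity of \<open>f\<close> says that this defect is nonnegative. It is
  linear in \<open>f\<close> and vanishes on affine functions, so it can be checked on the building
  blocks of \<open>f\<close>.\<close>

definition gap :: "(real \<Rightarrow> real) \<Rightarrow> 'a \<Rightarrow> real"
  where "gap f x = t * qform (rfc A f) x + (1 - t) * qform (rfc B f) x - qform (rfc C f) x"

lemma gap_cong:
  assumes "\<And>y. 0 \<le> y \<Longrightarrow> f y = g y"
  shows "gap f x = gap g x"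
proof -
  have "rfc D f = rfc D g" if "positive_op D" for D
    by (rule rfc_cong[OF that]) (rule assms)
  from this[OF A] this[OF B] this[OF C] show ?thesis by (simp add: gap_def)
qed

lemma gap_add:
  assumes "continuous_on {0..} f" "continuous_on {0..} g"
  shows "gap (\<lambda>x. f x + g x) x = gap f x + gap g x"
  by (simp add: gap_def rfc_add A B C assms blinfun.add_left cinner_add_left algebra_simps)

lemma gap_cmult:
  assumes "continuous_on {0..} f"
  shows "gap (\<lambda>x. c * f x) x = c * gap f x"
  by (simp add: gap_def rfc_cmult A B C assms blinfun.scaleR_left cinner.scaleR_left algebra_simps)

lemma gap_const: "gap (\<lambda>x. c) x = 0"
  by (simp add: gap_def rfc_const A B C blinfun.scaleR_left cinner.scaleR_left algebra_simps)

lemma gap_id: "gap (\<lambda>x. x) x = 0"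
  by (simp add: gap_def rfc_id A B C qform_C)

lemma gap_sum:
  assumes "finite F" "\<And>k. k \<in> F \<Longrightarrow> continuous_on {0..} (f k)"
  shows "gap (\<lambda>x. \<Sum>k\<in>F. f k x) x = (\<Sum>k\<in>F. gap (f k) x)"
  using assms
  by (induction F rule: finite_induct) (simp_all add: gap_const gap_add continuous_on_sum)

text \<open>Continuity of the defect under uniform approximation. The interval covers all three
  spectra; the factor 2 counts the convex average once and \<open>C\<close> once.\<close>

lemma abs_gap_le:
  assumes f: "continuous_on {0..} f"
    and M: "0 \<le> M" "\<And>y. 0 \<le> y \<Longrightarrow> y \<le> max (norm A) (norm B) \<Longrightarrow> \<bar>f y\<bar> \<le> M"
  shows "\<bar>gap f x\<bar> \<le> 2 * M * (norm x)\<^sup>2"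
proof -
  have *: "\<bar>qform D x\<bar> \<le> M * (norm x)\<^sup>2" if "norm D \<le> M" for D :: "'a \<Rightarrow>\<^sub>L 'a"
  proof -
    have "\<bar>qform D x\<bar> \<le> norm D * (norm x)\<^sup>2"
      using qform_le_norm[of D x] qform_le_norm[of "- D" x]
      by (simp add: blinfun.minus_left cinner.minus_left)
    also have "\<dots> \<le> M * (norm x)\<^sup>2" using that by (rule mult_right_mono) simp
    finally show ?thesis .
  qed
  have nC: "norm C \<le> max (norm A) (norm B)" unfolding C_def by (rule norm_convex_le[OF t])
  have "\<bar>qform (rfc A f) x\<bar> \<le> M * (norm x)\<^sup>2" "\<bar>qform (rfc B f) x\<bar> \<le> M * (norm x)\<^sup>2"
      "\<bar>qform (rfc C f) x\<bar> \<le> M * (norm x)\<^sup>2"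
    using nC by (auto intro!: * norm_rfc_le A B C f M)
  moreover from this have "\<bar>t * qform (rfc A f) x + (1 - t) * qform (rfc B f) x\<bar> \<le> M * (norm x)\<^sup>2"
    using t convex_bound_le[of "qform (rfc A f) x" "M * (norm x)\<^sup>2" "qform (rfc B f) x" t "1 - t"]
      convex_bound_le[of "- qform (rfc A f) x" "M * (norm x)\<^sup>2" "- qform (rfc B f) x" t "1 - t"]
    by (auto simp: abs_le_iff)
  ultimately show ?thesis unfolding gap_def by (simp add: abs_le_iff)
qed

text \<open>Since the form of the square of \<open>D\<close> is the squared norm of
  \<open>D x\<close>, the claim reduces to convexity of the squared norm.\<close>

lemma gap_square_nonneg: "0 \<le> gap (\<lambda>x. x\<^sup>2) x"
proof -
  have sq: "qform (rfc D (\<lambda>x. x\<^sup>2)) x = (norm (D x))\<^sup>2" if "positive_op D" for D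
    using rfc_mult[OF that, of "\<lambda>x. x" "\<lambda>x. x"] selfadjoint_opD(2)[OF positive_opD(1)[OF that], of "D x" x]
    by (simp add: power2_eq_square[of "_::real", symmetric] rfc_id that continuous_on_id Re_cinner_self)
  have "norm (C x) \<le> t * norm (A x) + (1 - t) * norm (B x)"
    using norm_triangle_ineq[of "t *\<^sub>R A x" "(1 - t) *\<^sub>R B x"] t
    by (simp add: C_def blinfun.add_left blinfun.scaleR_left)
  then have "(norm (C x))\<^sup>2 \<le> (t * norm (A x) + (1 - t) * norm (B x))\<^sup>2"
    by (rule power_mono) simp
  also have "\<dots> = t * (norm (A x))\<^sup>2 + (1 - t) * (norm (B x))\<^sup>2
      - t * (1 - t) * (norm (A x) - norm (B x))\<^sup>2"
    by (simp add: power2_eq_square algebra_simps)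
  also have "\<dots> \<le> t * (norm (A x))\<^sup>2 + (1 - t) * (norm (B x))\<^sup>2"
    using t by simp
  finally show ?thesis by (simp add: gap_def sq A B C)
qed

text \<open>The inverse is operator convex because \<open>\<langle>D\<inverse> x, x\<rangle>\<close> is the supremum over \<open>y\<close> of
  \<open>2 Re \<langle>x, y\<rangle> - \<langle>D y, y\<rangle>\<close>, which is affine in \<open>D\<close>.\<close>

lemma gap_resolvent_nonneg:
  assumes s: "0 < s"
  shows "0 \<le> gap (\<lambda>x. 1 / (x + s)) x"
proof -
  let ?f = "\<lambda>x::real. 1 / (x + s)"
  have f: "continuous_on {0..} ?f" by (intro continuous_intros) (use s in auto)
  have inv: "D (rfc D ?f y) + s *\<^sub>R rfc D ?f y = y" if D: "positive_op D" for D y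
  proof -
    have "rfc D (\<lambda>x. (x + s) * ?f x) = rfc D (\<lambda>x. x + s) o\<^sub>L rfc D ?f"
      by (intro rfc_mult D f continuous_intros)
    also have "rfc D (\<lambda>x. x + s) = D + s *\<^sub>R id_blinfun"
      by (subst rfc_add) (auto intro!: continuous_intros simp: D rfc_id rfc_const)
    also have "rfc D (\<lambda>x. (x + s) * ?f x) = rfc D (\<lambda>x. 1)"
      by (rule rfc_cong[OF D]) (use s in simp)
    also have "rfc D (\<lambda>x. 1) = id_blinfun" by (simp add: rfc_const D)
    finally have "id_blinfun y = ((D + s *\<^sub>R id_blinfun) o\<^sub>L rfc D ?f) y" by simp
    then show ?thesis by (simp add: blinfun.add_left blinfun.scaleR_left)
  qed
  have var: "2 * Re (cinner x y) - (qform D y + s * (norm y)\<^sup>2) \<le> qform (rfc D ?f) x"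
    if D: "positive_op D" for D y
  proof -
    define u where "u = rfc D ?f x"
    have x: "x = D u + s *\<^sub>R u" using inv[OF D, of x] by (simp add: u_def)
    \<comment> \<open>Completing the square: the form of \<open>D + s I\<close> is nonnegative at
      \<open>u - y\<close>, with equality for \<open>y = u\<close>.\<close>
    have "0 \<le> qform D (u - y) + s * (norm (u - y))\<^sup>2"
      using positive_opD(3)[OF D] s by simp
    also have "\<dots> = Re (cinner u x) - 2 * Re (cinner x y) + (qform D y + s * (norm y)\<^sup>2)"
      using selfadjoint_opD(2)[OF positive_opD(1)[OF D], of y u] Re_cinner_commute[of y "D u"]
        Re_cinner_commute[of u "D u"] Re_cinner_commute[of y u]
      by (simp add: x blinfun.diff_right cinner.diff_left cinner.diff_right cinner_add_left
          cinner_add_right cinner.scaleR_left cinner.scaleR_right Re_cinner_self[symmetric] algebra_simps)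
    finally show ?thesis by (simp add: u_def)
  qed
  \<comment> \<open>The maximiser for \<open>C\<close>; used as a competitor for \<open>A\<close>
    and \<open>B\<close>, it is only a lower bound there.\<close>
  define y where "y = rfc C ?f x"
  have "qform (rfc C ?f) x = 2 * Re (cinner x y) - (qform C y + s * (norm y)\<^sup>2)"
  proof -
    have "x = C y + s *\<^sub>R y" using inv[OF C, of x] by (simp add: y_def)
    then have "Re (cinner x y) = qform C y + s * (norm y)\<^sup>2"
      by (simp add: cinner_add_left cinner.scaleR_left Re_cinner_self)
    then show ?thesis using Re_cinner_commute[of x y] by (simp add: y_def)
  qed
  also have "\<dots> = t * (2 * Re (cinner x y) - (qform A y + s * (norm y)\<^sup>2))
      + (1 - t) * (2 * Re (cinner x y) - (qform B y + s * (norm y)\<^sup>2))"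
    by (simp add: qform_C algebra_simps)
  also have "\<dots> \<le> t * qform (rfc A ?f) x + (1 - t) * qform (rfc B ?f) x"
    using t by (intro add_mono mult_left_mono var A B) auto
  finally show ?thesis by (simp add: gap_def)
qed

text \<open>The product form matches what remains after multiplying a resolvent approximation of
  \<open>x powr (r - 1)\<close> by \<open>x\<close>.\<close>

lemma gap_square_resolvent_nonneg:
  assumes s: "0 < s"
  shows "0 \<le> gap (\<lambda>x. x * (x / (x + s))) x"
proof -
  have f: "continuous_on {0..} (\<lambda>x::real. 1 / (x + s))" by (intro continuous_intros) (use s in auto)
  have "gap (\<lambda>x. x * (x / (x + s))) x = gap (\<lambda>x. (x + - s) + s\<^sup>2 * (1 / (x + s))) x"
    by (rule gap_cong) (use s in \<open>simp add: field_simps power2_eq_square\<close>)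
  also have "\<dots> = gap (\<lambda>x. x + - s) x + s\<^sup>2 * gap (\<lambda>x. 1 / (x + s)) x"
    by (subst gap_add) (simp_all only: gap_cmult[OF f], (intro continuous_intros f)+)
  also have "gap (\<lambda>x. x + - s) x = 0"
    by (subst gap_add) (auto intro: continuous_intros simp only: gap_id gap_const)
  finally show ?thesis using gap_resolvent_nonneg[OF s, of x] by simp
qed

lemma gap_powr_nonneg:
  assumes r: "1 \<le> r" "r \<le> 2"
  shows "0 \<le> gap (\<lambda>x. x powr r) x"
proof -
  have r0: "0 < r" using r by simp
  note cont = continuous_on_powr_atLeast[OF r0]
  consider "r = 1" | "r = 2" | "1 < r" "r < 2" using r by linarith
  then show ?thesis
  proof cases
    case 1
    have "gap (\<lambda>x. x powr r) x = gap (\<lambda>x. x) x" by (rule gap_cong) (simp add: 1)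
    then show ?thesis by (simp add: gap_id)
  next
    case 2
    have "gap (\<lambda>x. x powr r) x = gap (\<lambda>x. x\<^sup>2) x" by (rule gap_cong) (simp add: 2)
    then show ?thesis by (simp add: gap_square_nonneg)
  next
    case 3
    \<comment> \<open>Adding 1 keeps \<open>R\<close> positive when both norms vanish.\<close>
    define R where "R = max (norm A) (norm B) + 1"
    have R: "0 < R" by (simp add: R_def add_nonneg_pos le_max_iff_disj)
    have "0 \<le> gap (\<lambda>x. x powr r) x + e" if e: "0 < e" for e
    proof -
      \<comment> \<open>Multiplying the approximation by \<open>y\<close> costs a factor
        \<open>R\<close> and \<open>abs_gap_le\<close> costs \<open>2 * (norm x)\<^sup>2\<close>;
        the final error is \<open>E * (norm x)\<^sup>2\<close>, at most \<open>e\<close>. The added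
        1 covers \<open>x = 0\<close>.\<close>
      define E where "E = e / ((norm x)\<^sup>2 + 1)"
      define d where "d = E / (2 * R)"
      have d: "0 < d" using e R by (simp add: d_def E_def add_nonneg_pos)
      obtain F c s where F: "finite (F :: int set)" "\<And>k. 0 \<le> (c k :: real)" "\<And>k. 0 < (s k :: real)"
        and approx: "\<And>x. 0 \<le> x \<Longrightarrow> x \<le> R \<Longrightarrow> \<bar>x powr (r - 1) - (\<Sum>k\<in>F. c k * (x / (x + s k)))\<bar> \<le> d"
        using powr_approx_resolvents[of "r - 1" R d] 3 R d by auto
      define g where "g y = (\<Sum>k\<in>F. c k * (y * (y / (y + s k))))" for y
      have hk: "continuous_on {0..} (\<lambda>y. y * (y / (y + s k)))" for k
        by (intro continuous_intros) (use F(3)[of k] in auto)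
      have g: "continuous_on {0..} g" unfolding g_def by (intro continuous_intros hk)
      have "0 \<le> gap g x"
        unfolding g_def using F
        by (subst gap_sum)
          (auto intro!: sum_nonneg mult_nonneg_nonneg gap_square_resolvent_nonneg continuous_on_mult_left hk
            simp: gap_cmult hk simp del: times_divide_eq_right)
      moreover have "\<bar>gap (\<lambda>y. y powr r + - 1 * g y) x\<bar> \<le> 2 * (R * d) * (norm x)\<^sup>2"
      proof (rule abs_gap_le)
        show "continuous_on {0..} (\<lambda>y. y powr r + - 1 * g y)" by (intro continuous_intros cont g)
        fix y assume y: "0 \<le> y" "y \<le> max (norm A) (norm B)"
        then have yR: "y \<le> R" by (simp add: R_def)
        have "y powr r = y * y powr (r - 1)"
        proof (cases "y = 0")
          case False
          then show ?thesis using y powr_add[of y 1 "r - 1"] by simp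
        qed simp
        then have "y powr r + - 1 * g y = y * (y powr (r - 1) - (\<Sum>k\<in>F. c k * (y / (y + s k))))"
          by (simp add: g_def right_diff_distrib sum_distrib_left mult.left_commute sum_negf)
        then have "\<bar>y powr r + - 1 * g y\<bar> = y * \<bar>y powr (r - 1) - (\<Sum>k\<in>F. c k * (y / (y + s k)))\<bar>"
          using y by (simp add: abs_mult)
        also have "\<dots> \<le> R * d" using approx[OF y(1) yR] y yR d by (intro mult_mono) auto
        finally show "\<bar>y powr r + - 1 * g y\<bar> \<le> R * d" .
      qed (use R d in simp)
      moreover have "gap (\<lambda>y. y powr r + - 1 * g y) x = gap (\<lambda>y. y powr r) x + - 1 * gap g x"
        by (subst gap_add) (auto intro!: cont continuous_intros g simp only: gap_cmult[OF g])
      moreover have "2 * (R * d) * (norm x)\<^sup>2 \<le> e"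
      proof -
        have "2 * (R * d) * (norm x)\<^sup>2 = E * (norm x)\<^sup>2"
          using R by (simp add: d_def)
        also have "\<dots> = e * ((norm x)\<^sup>2 / ((norm x)\<^sup>2 + 1))" by (simp add: E_def)
        also have "\<dots> \<le> e * 1"
          using e by (intro mult_left_mono) (auto simp: divide_le_eq_1 add_nonneg_pos)
        finally show ?thesis by simp
      qed
      ultimately show ?thesis by linarith
    qed
    then show ?thesis by (rule field_le_epsilon)
  qed
qed

end

lemma op_powr_operator_convex:
  assumes A: "positive_op A" and B: "positive_op B" and t: "0 \<le> t" "t \<le> 1"
    and r: "1 \<le> r" "r \<le> 2"
  shows "qform (op_powr (t *\<^sub>R A + (1 - t) *\<^sub>R B) r) x
    \<le> t * qform (op_powr A r) x + (1 - t) * qform (op_powr B r) x"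
proof -
  interpret convex_combination A B "t *\<^sub>R A + (1 - t) *\<^sub>R B" t
    by unfold_locales (use assms in auto)
  show ?thesis using gap_powr_nonneg[OF r, of x] r
    by (simp add: gap_def op_powr_eq_rfc A B C)
qed

section \<open>Integrating powers along a segment of positive operators\<close>

lemma continuous_on_poly_op:
  assumes "continuous_on X D"
  shows "continuous_on X (\<lambda>t. poly_op (D t) p)"
  by (induction p) (auto intro!: continuous_intros assms
      bounded_bilinear.continuous_on[OF bounded_bilinear_blinfun_compose])

text \<open>The spectra vary with \<open>t\<close> but stay in \<open>{0..R}\<close>. Polynomials
  approximating the power there do so for all \<open>t\<close> at once, which exhibits the powers as
  a uniform limit of continuous functions.\<close>

lemma continuous_on_op_powr:
  assumes D: "\<And>t. t \<in> X \<Longrightarrow> positive_op (D t)" and cont: "continuous_on X D"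
    and bound: "\<And>t. t \<in> X \<Longrightarrow> norm (D t) \<le> R" and r: "0 < r"
  shows "continuous_on X (\<lambda>t. op_powr (D t) r)"
proof -
  define Y where "Y = complex_of_real ` {0..R}"
  have Y: "compact Y" unfolding Y_def by (intro compact_continuous_image continuous_intros) auto
  define f where "f z = complex_of_real (Re z powr r)" for z
  have f: "continuous_on Y f" unfolding f_def
    by (intro continuous_intros continuous_on_powr') (use r in \<open>auto simp: Y_def\<close>)
  obtain P where P: "uniform_limit Y (\<lambda>n. poly (P n)) f sequentially"
    by (rule uniform_limit_poly_real[OF Y _ f]) (auto simp: Y_def)
  have "uniform_limit X (\<lambda>n t. poly_op (D t) (P n)) (\<lambda>t. op_powr (D t) r) sequentially"
  proof (rule uniform_limitI)
    fix e :: real assume e: "0 < e"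
    then have "0 < e / 2" by simp
    from uniform_limitD[OF P this]
    show "\<forall>\<^sub>F n in sequentially. \<forall>t\<in>X. dist (poly_op (D t) (P n)) (op_powr (D t) r) < e"
    proof eventually_elim
      case (elim n)
      show ?case
      proof
        fix t assume t: "t \<in> X"
        note pos = D[OF t] and sa = positive_opD(1)[OF D[OF t]]
        have sub: "op_spectrum (D t) \<subseteq> Y"
        proof
          fix z assume "z \<in> op_spectrum (D t)"
          from op_spectrum_positive[OF pos this] bound[OF t] show "z \<in> Y"
            unfolding Y_def by (intro image_eqI[of _ _ "Re z"]) auto
        qed
        have cf: "continuous_on (op_spectrum (D t)) f" by (rule continuous_on_subset[OF f sub])
        have "op_powr (D t) r = cfc (D t) f" unfolding f_def by (simp add: op_powr_eq_rfc[OF pos r] rfc_def)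
        moreover have "cfc (D t) (poly (P n)) = cfc (D t) (\<lambda>z. (poly (P n) z - f z) + f z)" by simp
        moreover have "\<dots> = cfc (D t) (\<lambda>z. poly (P n) z - f z) + cfc (D t) f"
          by (intro cfc_add sa continuous_intros cf)
        ultimately have "poly_op (D t) (P n) - op_powr (D t) r = cfc (D t) (\<lambda>z. poly (P n) z - f z)"
          by (simp add: cfc_poly[OF sa])
        moreover have "norm (cfc (D t) (\<lambda>z. poly (P n) z - f z)) \<le> e / 2"
        proof (rule norm_cfc_le[OF sa])
          show "cmod (poly (P n) z - f z) \<le> e / 2" if "z \<in> op_spectrum (D t)" for z
            using elim sub that by (force simp: dist_norm intro: less_imp_le)
        qed (use e in \<open>auto intro!: continuous_intros cf\<close>)
        ultimately show "dist (poly_op (D t) (P n)) (op_powr (D t) r) < e"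
          using e by (simp add: dist_norm)
      qed
    qed
  qed
  then show ?thesis
    by (rule uniform_limit_theorem[rotated]) (auto intro!: always_eventually continuous_on_poly_op cont)
qed

lemma bounded_linear_qform: "bounded_linear (\<lambda>A. qform A x)"
  by (intro bounded_linear_compose[OF bounded_linear_Re]
      bounded_linear_compose[OF cinner.bounded_linear_left] blinfun.bounded_linear_left)

lemma positive_op_op_powr:
  assumes "positive_op A" "0 < r"
  shows "positive_op (op_powr A r)"
  unfolding op_powr_eq_rfc[OF assms]
  by (rule positive_rfc[OF assms(1) continuous_on_powr_atLeast[OF assms(2)]]) simp

text \<open>Each requirement is tested by bounded real-linear maps, which commute with the integral.
  Complex linearity must be included, since elements of the type are only real-linear.\<close>

lemma positive_op_integral:
  fixes D :: "real \<Rightarrow> 'a::complex_hilbert_space \<Rightarrow>\<^sub>L 'a"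
  assumes D: "\<And>t. t \<in> S \<Longrightarrow> positive_op (D t)" and int: "D integrable_on S"
  shows "positive_op (integral S D)"
proof -
  note [simp] = bounded_linear_compose[OF cinner.bounded_linear_left blinfun.bounded_linear_left]
    bounded_linear_compose[OF cinner.bounded_linear_right blinfun.bounded_linear_left]
    blinfun.bounded_linear_left bounded_linear_qform
    bounded_linear_compose[OF scaleC.bounded_linear_right blinfun.bounded_linear_left]
  have lin: "h (integral S D) = integral S (\<lambda>t. h (D t))" if "bounded_linear h"
    for h :: "('a \<Rightarrow>\<^sub>L 'a) \<Rightarrow> 'b::banach"
    using integral_linear[OF int that] by (simp add: o_def)
  have "integral S D (c *\<^sub>C x) = c *\<^sub>C integral S D x" for c x
    using lin[of "\<lambda>A. A (c *\<^sub>C x)"] lin[of "\<lambda>A. c *\<^sub>C A x"]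
      integral_cong[of S "\<lambda>t. D t (c *\<^sub>C x)" "\<lambda>t. c *\<^sub>C D t x"]
    by (simp add: bounded_operatorsD[OF positive_opD(2)[OF D]])
  moreover have "cinner (integral S D x) y = cinner x (integral S D y)" for x y
    using lin[of "\<lambda>A. cinner (A x) y"] lin[of "\<lambda>A. cinner x (A y)"]
      integral_cong[of S "\<lambda>t. cinner (D t x) y" "\<lambda>t. cinner x (D t y)"]
    by (simp add: selfadjoint_opD(2)[OF positive_opD(1)[OF D]])
  moreover have "0 \<le> qform (integral S D) x" for x
  proof -
    have "(\<lambda>t. qform (D t) x) integrable_on S"
      using integrable_linear[OF int bounded_linear_qform] by (simp add: o_def)
    then show ?thesis using lin[of "\<lambda>A. qform A x"]
      by (auto intro!: integral_nonneg positive_opD(3) D)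
  qed
  ultimately show ?thesis
    by (simp add: positive_op_def selfadjoint_op_def in_bounded_operators)
qed

section \<open>The two inequalities for an operator and its adjoint\<close>

lemma qform_cadjoint_compose:
  "T \<in> bounded_operators \<Longrightarrow> qform (cadjoint T o\<^sub>L T) x = (norm (T x))\<^sup>2"
  by (simp add: cinner_cadjoint_left Re_cinner_self)

lemma qform_compose_cadjoint:
  assumes "T \<in> bounded_operators"
  shows "qform (T o\<^sub>L cadjoint T) x = (norm (cadjoint T x))\<^sup>2"
  by (simp add: cinner_cadjoint[OF assms] Re_cinner_self)

lemma positive_cadjoint_compose:
  assumes "T \<in> bounded_operators"
  shows "positive_op (cadjoint T o\<^sub>L T)"
  unfolding positive_op_def selfadjoint_op_def qform_cadjoint_compose[OF assms]
  by (simp add: assms cinner_cadjoint_left[OF assms] cinner_cadjoint[OF assms, symmetric])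

lemma positive_compose_cadjoint:
  assumes "T \<in> bounded_operators"
  shows "positive_op (T o\<^sub>L cadjoint T)"
  unfolding positive_op_def selfadjoint_op_def qform_compose_cadjoint[OF assms]
  by (simp add: assms cinner_cadjoint[OF assms] cinner_cadjoint_left[OF assms, symmetric])

theorem corollary2p14:
  fixes T :: "'a::complex_hilbert_space \<Rightarrow>\<^sub>L 'a" and r :: real
  assumes "T \<in> bounded_operators" and "1 \<le> r" and "r \<le> 2"
  shows "(numerical_radius T)\<^sup>2 \<le>
      norm (integral {0..1} (\<lambda>t::real.
        op_powr (t *\<^sub>R (cadjoint T o\<^sub>L T) + (1 - t) *\<^sub>R (T o\<^sub>L cadjoint T)) r)) powr (1 / r)
    \<and> norm (integral {0..1} (\<lambda>t::real.
        op_powr (t *\<^sub>R (cadjoint T o\<^sub>L T) + (1 - t) *\<^sub>R (T o\<^sub>L cadjoint T)) r)) powr (1 / r)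
      \<le> norm ((1 / 2) *\<^sub>R (op_powr (cadjoint T o\<^sub>L T) r + op_powr (T o\<^sub>L cadjoint T) r))
          powr (1 / r)"
proof -
  define A where "A = cadjoint T o\<^sub>L T"
  define B where "B = T o\<^sub>L cadjoint T"
  define C where "C t = t *\<^sub>R A + (1 - t) *\<^sub>R B" for t :: real
  define I where "I = integral {0..1} (\<lambda>t. op_powr (C t) r)"
  define H where "H = (1 / 2) *\<^sub>R (op_powr A r + op_powr B r)"
  have r0: "0 < r" using assms by simp
  have A: "positive_op A" and B: "positive_op B"
    unfolding A_def B_def using assms(1)
    by (rule positive_cadjoint_compose positive_compose_cadjoint)+
  have C: "positive_op (C t)" if "t \<in> {0..1}" for t
    unfolding C_def using that by (intro positive_op_convex A B) auto
  have "continuous_on {0..1} (\<lambda>t. op_powr (C t) r)"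
  proof (rule continuous_on_op_powr[OF C _ _ r0])
    show "continuous_on {0..1} C" unfolding C_def by (intro continuous_intros)
    show "norm (C t) \<le> max (norm A) (norm B)" if "t \<in> {0..1}" for t
      unfolding C_def using that by (intro norm_convex_le) auto
  qed
  then have int: "(\<lambda>t. op_powr (C t) r) integrable_on {0..1}"
    by (rule integrable_continuous_real)
  have I: "positive_op I" unfolding I_def
    by (rule positive_op_integral[OF _ int]) (intro positive_op_op_powr C r0)
  have intq: "(\<lambda>t. qform (op_powr (C t) r) x) integrable_on {0..1}" for x
    using integrable_linear[OF int bounded_linear_qform] by (simp add: o_def)
  have qI: "qform I x = integral {0..1} (\<lambda>t. qform (op_powr (C t) r) x)" for x
    using integral_linear[OF int bounded_linear_qform, of x] by (simp add: I_def o_def)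
  \<comment> \<open>A square root appears because the numerical radius is a supremum of unsquared
    moduli.\<close>
  have w: "cmod (cinner (T x) x) \<le> sqrt (norm I powr (1 / r))" if x: "norm x = 1" for x
  proof -
    define a where "a = (cmod (cinner (T x) x))\<^sup>2"
    have "cmod (cinner (T x) x) \<le> norm (T x)" "cmod (cinner (T x) x) \<le> norm (cadjoint T x)"
      using cmod_cinner_le[of "T x" x] cmod_cinner_le[of x "cadjoint T x"]
      by (simp_all add: x cinner_cadjoint[OF assms(1)])
    then have aA: "a \<le> qform A x" and aB: "a \<le> qform B x"
      unfolding a_def A_def B_def qform_cadjoint_compose[OF assms(1)] qform_compose_cadjoint[OF assms(1)]
      by (simp_all add: power_mono)
    have "a powr r \<le> qform (op_powr (C t) r) x" if t: "t \<in> {0..1}" for t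
    proof -
      have "a = t * a + (1 - t) * a" by (simp add: algebra_simps)
      also have "\<dots> \<le> t * qform A x + (1 - t) * qform B x"
        using t aA aB by (intro add_mono mult_left_mono) auto
      also have "\<dots> = qform (C t) x"
        by (simp add: C_def blinfun.add_left blinfun.scaleR_left cinner_add_left cinner.scaleR_left)
      finally have "a powr r \<le> qform (C t) x powr r"
        using r0 by (intro powr_mono2) (auto simp: a_def)
      also have "\<dots> \<le> qform (op_powr (C t) r) x" by (rule op_powr_Jensen[OF C[OF t] assms(2) x])
      finally show ?thesis .
    qed
    then have "integral {0..1} (\<lambda>t::real. a powr r) \<le> qform I x"
      unfolding qI by (intro integral_le intq integrable_const_ivl) auto
    also have "\<dots> \<le> norm I" using qform_le_norm[of I x] by (simp add: x)
    finally have "(a powr r) powr (1 / r) \<le> norm I powr (1 / r)"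
      using r0 by (intro powr_mono2) auto
    then have "a \<le> norm I powr (1 / r)" using r0 by (simp add: powr_powr a_def)
    then show ?thesis by (simp add: a_def real_le_rsqrt)
  qed
  \<comment> \<open>The bound is nonnegative, so it also covers the added \<open>0\<close>, and the
    zero space needs no separate case.\<close>
  let ?W = "insert 0 {cmod (cinner (T x) x) | x. norm x = 1}"
  have bound: "y \<le> sqrt (norm I powr (1 / r))" if "y \<in> ?W" for y
    using that w by auto
  have "0 \<le> numerical_radius T" unfolding numerical_radius_def
    by (rule cSup_upper) (use bound in \<open>auto intro!: bdd_aboveI\<close>)
  moreover have "numerical_radius T \<le> sqrt (norm I powr (1 / r))" unfolding numerical_radius_def
    by (rule cSup_least) (use bound in auto)
  ultimately have "(numerical_radius T)\<^sup>2 \<le> (sqrt (norm I powr (1 / r)))\<^sup>2"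
    by (intro power_mono)
  then have first: "(numerical_radius T)\<^sup>2 \<le> norm I powr (1 / r)" by simp
  \<comment> \<open>As \<open>I\<close> is positive, its norm is controlled by its quadratic form,
    so comparing forms pointwise is enough.\<close>
  have "norm I \<le> norm H"
  proof (rule norm_positive_op_le[OF I])
    fix x
    let ?a = "qform (op_powr A r) x" and ?b = "qform (op_powr B r) x"
    \<comment> \<open>The mean of \<open>t\<close> over the unit interval is the source of the
      factor \<open>1 / 2\<close>.\<close>
    have lin: "((\<lambda>t. t * ?a + (1 - t) * ?b) has_integral (?a + ?b) / 2) {0..1}"
    proof -
      have "((\<lambda>t. ?b + (?a - ?b) * t) has_integral ?b + (?a - ?b) * (1 / 2)) {0..1}"
        using has_integral_add[OF has_integral_const_real[of ?b 0 1]
            has_integral_mult_right[OF ident_has_integral[of 0 1], of "?a - ?b"]] by simp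
      then show ?thesis by (simp add: algebra_simps add_divide_distrib diff_divide_distrib)
    qed
    have "qform I x \<le> (?a + ?b) / 2" unfolding qI
      by (rule has_integral_le[OF integrable_integral[OF intq] lin])
        (use assms in \<open>auto simp: C_def intro!: op_powr_operator_convex A B\<close>)
    also have "\<dots> = qform H x"
      by (simp add: H_def blinfun.add_left blinfun.scaleR_left cinner_add_left cinner.scaleR_left)
    also have "\<dots> \<le> norm H * (norm x)\<^sup>2" by (rule qform_le_norm)
    finally show "qform I x \<le> norm H * (norm x)\<^sup>2" .
  qed simp
  then have "norm I powr (1 / r) \<le> norm H powr (1 / r)"
    using r0 by (intro powr_mono2) auto
  with first show ?thesis unfolding I_def H_def C_def A_def B_def by (rule conjI)
qed

end
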